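(* Let $(a,b,c)\in\mathbb{R}_{>0}^3$ satisfy $a>b+c$ or $b>a+c$ (the ferroelectric phase). Then there exist boundary conditions on $\Lambda_n$ (one choice for each $n$) for which the Glauber dynamics for the six-vertex model with weights $(a,b,c)$ on $\Lambda_n$ mixes exponentially slowly, i.e. its mixing time $\tau(1/4)$ is $\Omega(\exp(n^{\kappa}))$ for some constant $\kappa>0$.
   Context: $\Lambda_n$ is the $n\times n$ square grid of $\mathbb{Z}^2$ together with $4n$ additional dangling boundary edges, so that each of the $n^2$ vertices has degree 4. A configuration is an orientation of all edges in which every vertex has exactly two incoming and two outgoing edges (an Eulerian orientation). At a vertex $v$ the six possible local configurations fall into three classes: type $a$ (horizontal edges both pointing right and vertical edges both pointing up, or both pointing left and both down), type $b$ (horizontal both right and vertical both down, or horizontal both left and vertical both up), and type $c$ (both horizontal edges point into $v$ and both vertical edges point out of $v$, or vice versa). Boundary conditions fix the orientations of the $4n$ dangling edges; the state space $\Omega$ is the set of Eulerian orientations consistent with them. The Boltzmann distribution is $\pi(x)\propto a^{n_a(x)}b^{n_b(x)}c^{n_c(x)}$, where $n_a(x),n_b(x),n_c(x)$ count vertices of each type. Glauber dynamics: from state $x$, choose uniformly at random one of the internal cells (unit squares of the grid bounded by four grid edges); if its four bounding edges form a directed cycle, let $y$ be the state obtained by reversing these four edges and move to $y$ with probability $\min(1,\pi(y)/\pi(x))$; otherwise stay at $x$. The mixing time is $\tau(1/4)=\min\{t\ge 0: \max_{x\in\Omega}\|P^t(x,\cdot)-\pi\|_{TV}\le 1/4\}$,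 where $\|\mu-\nu\|_{TV}=\frac12\sum_{x}|\mu(x)-\nu(x)|$. *)

theory Defs
  imports "HOL-Probability.Probability"
begin

text \<open>
  The vertices of \<open>\<Lambda>\<^sub>n\<close> are the points \<open>(i, j)\<close> with \<open>1 \<le> i, j \<le> n\<close> (column \<open>i\<close>, row \<open>j\<close>, rows
  numbered upwards). \<open>Hor i j\<close> joins \<open>(i, j)\<close> to \<open>(i + 1, j)\<close> and \<open>Ver i j\<close> joins \<open>(i, j)\<close> to
  \<open>(i, j + 1)\<close>; a dangling edge has exactly one end outside the vertex set, at a coordinate
  \<open>0\<close> or \<open>n + 1\<close>.
\<close>

type_synonym vertex = "nat \<times> nat"

datatype edge = Hor nat nat | Ver nat nat

fun lower_end :: "edge \<Rightarrow> vertex" where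
  "lower_end (Hor i j) = (i, j)"
| "lower_end (Ver i j) = (i, j)"

fun upper_end :: "edge \<Rightarrow> vertex" where
  "upper_end (Hor i j) = (i + 1, j)"
| "upper_end (Ver i j) = (i, j + 1)"

definition vertices :: "nat \<Rightarrow> vertex set" where
  "vertices n = {1..n} \<times> {1..n}"

definition edges :: "nat \<Rightarrow> edge set" where
  "edges n = {e. lower_end e \<in> vertices n \<or> upper_end e \<in> vertices n}"

definition dangling_edges :: "nat \<Rightarrow> edge set" where
  "dangling_edges n = {e \<in> edges n. lower_end e \<notin> vertices n \<or> upper_end e \<notin> vertices n}"

text \<open>
  An orientation maps an edge to \<open>True\<close> iff the edge points right (horizontal) or up (vertical).
\<close>

type_synonym orientation = "edge \<Rightarrow> bool"

definition head :: "orientation \<Rightarrow> edge \<Rightarrow> vertex" where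
  "head x e = (if x e then upper_end e else lower_end e)"

definition tail :: "orientation \<Rightarrow> edge \<Rightarrow> vertex" where
  "tail x e = (if x e then lower_end e else upper_end e)"

definition eulerian :: "nat \<Rightarrow> orientation \<Rightarrow> bool" where
  "eulerian n x \<longleftrightarrow> (\<forall>v \<in> vertices n.
     card {e \<in> edges n. head x e = v} = 2 \<and> card {e \<in> edges n. tail x e = v} = 2)"

text \<open>
  Only the values of \<open>\<beta>\<close> on the dangling edges matter. States are taken extensional on the edge set,
  so that each orientation of the edges of \<open>\<Lambda>\<^sub>n\<close> is represented by one function.
\<close>

definition states :: "nat \<Rightarrow> orientation \<Rightarrow> orientation set" where
  "states n \<beta> = {x \<in> edges n \<rightarrow>\<^sub>E UNIV. eulerian n x \<and> (\<forall>e \<in> dangling_edges n. x e = \<beta> e)}"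

text \<open>
  The edges at \<open>(i, j)\<close> are \<open>Hor (i - 1) j\<close> (left), \<open>Hor i j\<close> (right), \<open>Ver i (j - 1)\<close> (below) and
  \<open>Ver i j\<close> (above); the subtractions are exact since \<open>i, j \<ge> 1\<close> at vertices.
\<close>

fun type_a :: "orientation \<Rightarrow> vertex \<Rightarrow> bool" where
  "type_a x (i, j) \<longleftrightarrow>
     x (Hor (i - 1) j) \<and> x (Hor i j) \<and> x (Ver i (j - 1)) \<and> x (Ver i j) \<or>
     \<not> x (Hor (i - 1) j) \<and> \<not> x (Hor i j) \<and> \<not> x (Ver i (j - 1)) \<and> \<not> x (Ver i j)"

fun type_b :: "orientation \<Rightarrow> vertex \<Rightarrow> bool" where
  "type_b x (i, j) \<longleftrightarrow>
     x (Hor (i - 1) j) \<and> x (Hor i j) \<and> \<not> x (Ver i (j - 1)) \<and> \<not> x (Ver i j) \<or>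
     \<not> x (Hor (i - 1) j) \<and> \<not> x (Hor i j) \<and> x (Ver i (j - 1)) \<and> x (Ver i j)"

fun type_c :: "orientation \<Rightarrow> vertex \<Rightarrow> bool" where
  "type_c x (i, j) \<longleftrightarrow>
     x (Hor (i - 1) j) \<and> \<not> x (Hor i j) \<and> \<not> x (Ver i (j - 1)) \<and> x (Ver i j) \<or>
     \<not> x (Hor (i - 1) j) \<and> x (Hor i j) \<and> x (Ver i (j - 1)) \<and> \<not> x (Ver i j)"

definition weight :: "real \<Rightarrow> real \<Rightarrow> real \<Rightarrow> nat \<Rightarrow> orientation \<Rightarrow> real" where
  "weight a b c n x =
     a ^ card {v \<in> vertices n. type_a x v} *
     b ^ card {v \<in> vertices n. type_b x v} *
     c ^ card {v \<in> vertices n. type_c x v}"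

definition boltzmann :: "real \<Rightarrow> real \<Rightarrow> real \<Rightarrow> nat \<Rightarrow> orientation \<Rightarrow> orientation \<Rightarrow> real" where
  "boltzmann a b c n \<beta> x = weight a b c n x / (\<Sum>y \<in> states n \<beta>. weight a b c n y)"

text \<open>A cell is named by its lower left corner.\<close>

definition cells :: "nat \<Rightarrow> vertex set" where
  "cells n = {1..<n} \<times> {1..<n}"

fun cell_edges :: "vertex \<Rightarrow> edge set" where
  "cell_edges (i, j) = {Hor i j, Ver (i + 1) j, Hor i (j + 1), Ver i j}"

text \<open>The two alternatives are the counterclockwise and the clockwise cycle.\<close>

fun directed_cycle :: "orientation \<Rightarrow> vertex \<Rightarrow> bool" where
  "directed_cycle x (i, j) \<longleftrightarrow>
     x (Hor i j) \<and> x (Ver (i + 1) j) \<and> \<not> x (Hor i (j + 1)) \<and> \<not> x (Ver i j) \<or>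
     \<not> x (Hor i j) \<and> \<not> x (Ver (i + 1) j) \<and> x (Hor i (j + 1)) \<and> x (Ver i j)"

definition reverse_cell :: "orientation \<Rightarrow> vertex \<Rightarrow> orientation" where
  "reverse_cell x q = (\<lambda>e. if e \<in> cell_edges q then \<not> x e else x e)"

text \<open>For \<open>n \<le> 1\<close> there are no cells, and the chain does not move.\<close>

definition glauber_step ::
  "real \<Rightarrow> real \<Rightarrow> real \<Rightarrow> nat \<Rightarrow> orientation \<Rightarrow> orientation \<Rightarrow> orientation pmf" where
  "glauber_step a b c n \<beta> x =
     (if cells n = {} then return_pmf x
      else bind_pmf (pmf_of_set (cells n)) (\<lambda>q.
        if directed_cycle x q then
          (let y = reverse_cell x q in
           map_pmf (\<lambda>accept. if accept then y else x)
             (bernoulli_pmf (min 1 (boltzmann a b c n \<beta> y / boltzmann a b c n \<beta> x))))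
        else return_pmf x))"

definition glauber_dist ::
  "real \<Rightarrow> real \<Rightarrow> real \<Rightarrow> nat \<Rightarrow> orientation \<Rightarrow> nat \<Rightarrow> orientation \<Rightarrow> orientation pmf" where
  "glauber_dist a b c n \<beta> t x =
     ((\<lambda>p. bind_pmf p (glauber_step a b c n \<beta>)) ^^ t) (return_pmf x)"

definition tv_dist :: "'s set \<Rightarrow> ('s \<Rightarrow> real) \<Rightarrow> ('s \<Rightarrow> real) \<Rightarrow> real" where
  "tv_dist S \<mu> \<nu> = 1 / 2 * (\<Sum>x \<in> S. \<bar>\<mu> x - \<nu> x\<bar>)"

text \<open>\<open>\<infinity>\<close> if the chain never comes within distance \<open>\<epsilon>\<close> of the Boltzmann distribution.\<close>

definition mixing_time ::
  "real \<Rightarrow> real \<Rightarrow> real \<Rightarrow> nat \<Rightarrow> orientation \<Rightarrow> real \<Rightarrow> enat" where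
  "mixing_time a b c n \<beta> \<epsilon> = Inf {enat t | t.
     (MAX x \<in> states n \<beta>.
        tv_dist (states n \<beta>) (pmf (glauber_dist a b c n \<beta> t x)) (boltzmann a b c n \<beta>)) \<le> \<epsilon>}"

end

theory Submission
  imports Defs "HOL-Real_Asymp.Real_Asymp"
begin

text \<open>
  Assume \<open>a > b + c\<close>; the case \<open>b > a + c\<close> follows by a left-right reflection. The edges pointing left
  or down form paths from the upper right to the lower left. Relative to the empty state, a path pays
  \<open>b / a\<close> at each vertex that it crosses straight and \<open>c / a\<close> at each turn, so a free path loses a
  factor \<open>(b + c) / a < 1\<close> per step, but a vertex shared by two paths costs nothing. The boundary
  conditions prescribe a fixed number \<open>K\<close> of paths whose end points lie on diagonals at mutual
  distance of order \<open>n powr (2 / 3)\<close>.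

  Let \<open>S\<close> be the set of states in which every path stays in a tube around its own diagonal. There the
  paths are independent persistent random walks, and a Chernoff bound shows that a path seldom comes
  near the boundary of its tube, whose width exceeds the diffusive scale \<open>n powr (1 / 2)\<close>; hence the
  states from which the dynamics can leave \<open>S\<close> carry an exponentially small part of the weight of
  \<open>S\<close>. On the other hand the state in which all \<open>K\<close> paths run side by side along one diagonal has at
  most \<open>3 n\<close> vertices not of type \<open>a\<close>, whatever \<open>K\<close> is, so for \<open>K\<close> large it outweighs all of \<open>S\<close>.
  Thus \<open>S\<close> has weight at most one half and a thin boundary, and the chain started in \<open>S\<close> stays there
  for an exponentially long time.
\<close>

section \<open>Local structure of states\<close>

text \<open>The escape rate must be measured against the weight of \<open>S\<close> itself, whose
  paths have both end points prescribed. Conditioning a walk to return costs only a polynomial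
  factor: two half walks with the same end point are glued, one of them reversed. Tilting by
  n^(-1/2) over tubes of width n^(2/3) gives exp(-n^(1/6)) up to polynomial factors, and the
  exponent 1/7 < 1/6 absorbs these. The exponent 2/3 has to lie above 1/2 for this bound and below 1
  so that a fixed number of tubes fits into the grid. The bound 3 n for the packed state consists of
  2 n for the two outer paths of the bundle, since a vertex between two neighbouring paths is used
  by both and has type a, and of O(K^2 n^(2/3)) vertices near the two corners, where the paths join
  and leave the bundle. Each of the K paths of a state in \<open>S\<close> visits at least n
  vertices, so \<open>S\<close> loses a factor ((b + c) / a)^(n K), and K is taken with ((b + c) /
  a)^K < min (b / a) (c / a)^3.\<close>

lemma Hor_in_edges [simp]: "Hor i j \<in> edges n \<longleftrightarrow> i \<le> n \<and> 1 \<le> j \<and> j \<le> n"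
  by (auto simp: edges_def vertices_def)

lemma Ver_in_edges [simp]: "Ver i j \<in> edges n \<longleftrightarrow> 1 \<le> i \<and> i \<le> n \<and> j \<le> n"
  by (auto simp: edges_def vertices_def)

lemma Hor_in_dangling_edges [simp]:
  "Hor i j \<in> dangling_edges n \<longleftrightarrow> (i = 0 \<or> i = n) \<and> 1 \<le> j \<and> j \<le> n"
  by (auto simp: dangling_edges_def vertices_def)

lemma Ver_in_dangling_edges [simp]:
  "Ver i j \<in> dangling_edges n \<longleftrightarrow> 1 \<le> i \<and> i \<le> n \<and> (j = 0 \<or> j = n)"
  by (auto simp: dangling_edges_def vertices_def)

lemma finite_edges [simp]: "finite (edges n)"
proof (rule finite_subset)
  show "edges n \<subseteq> (\<lambda>(i, j). Hor i j) ` ({..n} \<times> {..n}) \<union> (\<lambda>(i, j). Ver i j) ` ({..n} \<times> {..n})"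
  proof
    fix e assume "e \<in> edges n"
    then show "e \<in> (\<lambda>(i, j). Hor i j) ` ({..n} \<times> {..n}) \<union> (\<lambda>(i, j). Ver i j) ` ({..n} \<times> {..n})"
      by (cases e) auto
  qed
qed auto

lemma finite_vertices [simp]: "finite (vertices n)"
  by (simp add: vertices_def)

lemma finite_states [simp]: "finite (states n \<beta>)"
  by (rule finite_subset[of _ "edges n \<rightarrow>\<^sub>E UNIV"]) (auto simp: states_def intro!: finite_PiE)

lemma edges_at_vertex:
  assumes "(i, j) \<in> vertices n"
  shows "{e \<in> edges n. head x e = (i, j)} =
      {e \<in> {Hor (i - 1) j, Hor i j, Ver i (j - 1), Ver i j}. head x e = (i, j)}"
    and "{e \<in> edges n. tail x e = (i, j)} =
      {e \<in> {Hor (i - 1) j, Hor i j, Ver i (j - 1), Ver i j}. tail x e = (i, j)}"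
proof -
  have *: "e \<in> {Hor (i - 1) j, Hor i j, Ver i (j - 1), Ver i j}"
    if "lower_end e = (i, j) \<or> upper_end e = (i, j)" for e
    using that by (cases e) auto
  have **: "e \<in> edges n" if "e \<in> {Hor (i - 1) j, Hor i j, Ver i (j - 1), Ver i j}" for e
    using that assms by (auto simp: vertices_def)
  show "{e \<in> edges n. head x e = (i, j)} =
      {e \<in> {Hor (i - 1) j, Hor i j, Ver i (j - 1), Ver i j}. head x e = (i, j)}"
    using * ** by (auto simp: head_def split: if_splits)
  show "{e \<in> edges n. tail x e = (i, j)} =
      {e \<in> {Hor (i - 1) j, Hor i j, Ver i (j - 1), Ver i j}. tail x e = (i, j)}"
    using * ** by (auto simp: tail_def split: if_splits)
qed

lemma filter_insert: "{e \<in> insert u A. P e} = (if P u then insert u {e \<in> A. P e} else {e \<in> A. P e})"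
  by auto

text \<open>Of the sixteen orientations of the four edges at a vertex, exactly six have two edges in
  and two out; the case split checks all sixteen.\<close>

lemma eulerian_iff_types:
  "eulerian n x \<longleftrightarrow> (\<forall>v \<in> vertices n. type_a x v \<or> type_b x v \<or> type_c x v)"
proof -
  have "card {e \<in> edges n. head x e = v} = 2 \<and> card {e \<in> edges n. tail x e = v} = 2 \<longleftrightarrow>
      type_a x v \<or> type_b x v \<or> type_c x v" if v: "v \<in> vertices n" for v
  proof -
    obtain i j where ij: "v = (i, j)" by (cases v)
    have pos: "1 \<le> i" "1 \<le> j" using v ij by (auto simp: vertices_def)
    then have ne: "i - 1 \<noteq> i" "j - 1 \<noteq> j" "Suc (i - 1) = i" "Suc (j - 1) = j" by auto
    show ?thesis
      unfolding ij edges_at_vertex[OF v[unfolded ij]] filter_insert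
      by (cases "x (Hor (i - 1) j)"; cases "x (Hor i j)"; cases "x (Ver i (j - 1))"; cases "x (Ver i j)")
        (use pos ne in \<open>simp_all add: head_def tail_def\<close>)
  qed
  then show ?thesis by (auto simp: eulerian_def)
qed

lemma states_iff:
  "x \<in> states n \<beta> \<longleftrightarrow> x \<in> extensional (edges n) \<and>
     (\<forall>v \<in> vertices n. type_a x v \<or> type_b x v \<or> type_c x v) \<and>
     (\<forall>e \<in> dangling_edges n. x e = \<beta> e)"
  by (auto simp: states_def eulerian_iff_types PiE_def)

lemma weight_pos: "0 < a \<Longrightarrow> 0 < b \<Longrightarrow> 0 < c \<Longrightarrow> 0 < weight a b c n x"
  by (simp add: weight_def)

section \<open>Bottlenecks\<close>

lemma reverse_cell_twice [simp]: "reverse_cell (reverse_cell x q) q = x"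
  by (auto simp: reverse_cell_def)

lemma directed_cycle_reverse_cell [simp]: "directed_cycle (reverse_cell x q) q \<longleftrightarrow> directed_cycle x q"
  by (cases q) (auto simp: reverse_cell_def)

lemma reverse_cell_neq: "reverse_cell x q \<noteq> x"
proof -
  obtain i j where "q = (i, j)" by (cases q)
  then have "reverse_cell x q (Hor i j) \<noteq> x (Hor i j)" by (simp add: reverse_cell_def)
  then show ?thesis by metis
qed

text \<open>Each corner of a directed cell has one cell edge in and one out, so reversal keeps the
  degrees there. Other vertices see no change, and cell edges are never dangling.\<close>

lemma reverse_cell_in_states:
  assumes x: "x \<in> states n \<beta>" and q: "q \<in> cells n" and cyc: "directed_cycle x q"
  shows "reverse_cell x q \<in> states n \<beta>"
proof -
  obtain i j where ij: "q = (i, j)" by (cases q)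
  have b: "1 \<le> i" "i < n" "1 \<le> j" "j < n" using q ij by (auto simp: cells_def)
  have x': "x \<in> extensional (edges n)" "\<forall>e \<in> dangling_edges n. x e = \<beta> e"
    using x unfolding states_iff by blast+
  have ext: "reverse_cell x q \<in> extensional (edges n)"
    using x'(1) b by (auto simp: extensional_def reverse_cell_def ij)
  have dang: "\<forall>e \<in> dangling_edges n. reverse_cell x q e = \<beta> e"
    using x'(2) b by (auto simp: reverse_cell_def ij)
  have ty: "type_a (reverse_cell x q) v \<or> type_b (reverse_cell x q) v \<or> type_c (reverse_cell x q) v"
    if v: "v \<in> vertices n" for v
  proof -
    obtain k l where kl: "v = (k, l)" by (cases v)
    have pos: "1 \<le> k" "1 \<le> l" using v kl by (auto simp: vertices_def)
    have t: "type_a x (k, l) \<or> type_b x (k, l) \<or> type_c x (k, l)" using x v unfolding states_iff kl by blast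
    have e: "k - 1 = i \<longleftrightarrow> k = i + 1" "l - 1 = j \<longleftrightarrow> l = j + 1" "k - 1 = i + 1 \<longleftrightarrow> k = i + 2"
      "l - 1 = j + 1 \<longleftrightarrow> l = j + 2" using pos by auto
    consider "k = i" "l = j" | "k = i" "l = j + 1" | "k = i + 1" "l = j" | "k = i + 1" "l = j + 1"
      | "k \<noteq> i \<and> k \<noteq> i + 1 \<or> l \<noteq> j \<and> l \<noteq> j + 1" by blast
    then show ?thesis
    proof cases
      case 5
      then have "reverse_cell x q (Hor (k - 1) l) = x (Hor (k - 1) l)"
        "reverse_cell x q (Hor k l) = x (Hor k l)"
        "reverse_cell x q (Ver k (l - 1)) = x (Ver k (l - 1))"
        "reverse_cell x q (Ver k l) = x (Ver k l)"
        using e by (auto simp: reverse_cell_def ij)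
      then show ?thesis using t kl by simp
    qed (use t cyc b kl ij in \<open>auto simp: reverse_cell_def\<close>)
  qed
  show ?thesis using ext dang ty by (simp add: states_iff)
qed

section \<open>Reversibility of the dynamics and leakage from a set of states\<close>

context
  fixes a b c :: real and n :: nat and \<beta> :: orientation
  assumes abc: "0 < a" "0 < b" "0 < c"
begin

abbreviation "kern x y \<equiv> pmf (glauber_step a b c n \<beta> x) y"

lemma boltzmann_ratio:
  assumes "x \<in> states n \<beta>"
  shows "boltzmann a b c n \<beta> y / boltzmann a b c n \<beta> x = weight a b c n y / weight a b c n x"
proof -
  have "(\<Sum>y \<in> states n \<beta>. weight a b c n y) > 0"
    by (rule sum_pos) (use assms abc weight_pos in auto)
  then show ?thesis by (simp add: boltzmann_def)
qed

lemma set_pmf_glauber_step: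
  assumes "x \<in> states n \<beta>" "y \<in> set_pmf (glauber_step a b c n \<beta> x)"
  shows "y = x \<or> (\<exists>q \<in> cells n. directed_cycle x q \<and> y = reverse_cell x q)"
proof (cases "cells n = {}")
  case False
  have "finite (cells n)" by (simp add: cells_def)
  then show ?thesis using assms(2) False
    by (auto simp: glauber_step_def Let_def split: if_splits)
qed (use assms in \<open>auto simp: glauber_step_def\<close>)

lemma glauber_step_closed:
  "x \<in> states n \<beta> \<Longrightarrow> set_pmf (glauber_step a b c n \<beta> x) \<subseteq> states n \<beta>"
  using set_pmf_glauber_step reverse_cell_in_states by blast

lemma sum_kern: "x \<in> states n \<beta> \<Longrightarrow> (\<Sum>y \<in> states n \<beta>. kern x y) = 1"
  by (rule sum_pmf_eq_1) (use glauber_step_closed in auto)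

text \<open>Multiplying the acceptance probability min(1, w(y) / w(x)) by w(x) gives min(w(x),
  w(y)), which is symmetric. Keeping the sum over all cells avoids having to identify the one cell
  that leads from \<open>x\<close> to \<open>y\<close>.\<close>

lemma kern_neq:
  assumes x: "x \<in> states n \<beta>" and ne: "x \<noteq> y"
  shows "weight a b c n x * kern x y = (\<Sum>q \<in> cells n. if directed_cycle x q \<and> y = reverse_cell x q
      then min (weight a b c n x) (weight a b c n y) else 0) / real (card (cells n))"
proof (cases "cells n = {}")
  case True
  then show ?thesis using ne by (simp add: glauber_step_def)
next
  case False
  have fin: "finite (cells n)" by (simp add: cells_def)
  have wp: "weight a b c n z > 0" for z using abc weight_pos by auto
  have *: "weight a b c n x * pmf (if directed_cycle x q then
          (let y = reverse_cell x q in
           map_pmf (\<lambda>accept. if accept then y else x)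
             (bernoulli_pmf (min 1 (boltzmann a b c n \<beta> y / boltzmann a b c n \<beta> x))))
        else return_pmf x) y = (if directed_cycle x q \<and> y = reverse_cell x q
      then min (weight a b c n x) (weight a b c n y) else 0)" for q
  proof (cases "directed_cycle x q")
    case True
    define r where "r = min 1 (weight a b c n (reverse_cell x q) / weight a b c n x)"
    have r: "0 \<le> r" "r \<le> 1" using wp[of x] wp[of "reverse_cell x q"] by (auto simp: r_def)
    have "pmf (map_pmf (\<lambda>accept. if accept then reverse_cell x q else x) (bernoulli_pmf r)) y
        = (if y = reverse_cell x q then r else 0)"
      unfolding map_pmf_def by (subst pmf_bind) (use r ne reverse_cell_neq[of x q] in auto)
    moreover have "weight a b c n x * r = min (weight a b c n x) (weight a b c n (reverse_cell x q))"
      using wp[of x] by (simp add: r_def min_mult_distrib_left)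
    ultimately show ?thesis using True boltzmann_ratio[OF x] by (simp add: Let_def r_def)
  qed (use ne in auto)
  show ?thesis
    unfolding glauber_step_def if_not_P[OF False] pmf_bind_pmf_of_set[OF False fin]
      times_divide_eq_right sum_distrib_left * ..
qed

text \<open>Reversing a cell is an involution that preserves being a directed cycle, so both sides
  of the off-diagonal formula have the same summands.\<close>

lemma detailed_balance:
  assumes x: "x \<in> states n \<beta>" and y: "y \<in> states n \<beta>"
  shows "weight a b c n x * kern x y = weight a b c n y * kern y x"
proof (cases "x = y")
  case False
  have "directed_cycle x q \<and> y = reverse_cell x q \<longleftrightarrow> directed_cycle y q \<and> x = reverse_cell y q" for q
    by auto
  then show ?thesis
    unfolding kern_neq[OF x False] kern_neq[OF y False[symmetric]]
    by (simp only: min.commute[of "weight a b c n x"])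
qed simp

lemma weight_stationary:
  assumes y: "y \<in> states n \<beta>"
  shows "(\<Sum>x \<in> states n \<beta>. weight a b c n x * kern x y) = weight a b c n y"
proof -
  have "(\<Sum>x \<in> states n \<beta>. weight a b c n x * kern x y) = (\<Sum>x \<in> states n \<beta>. weight a b c n y * kern y x)"
    by (rule sum.cong) (use detailed_balance y in auto)
  also have "\<dots> = weight a b c n y" using sum_kern[OF y] by (simp flip: sum_distrib_left)
  finally show ?thesis .
qed

lemma glauber_dist_closed:
  "x \<in> states n \<beta> \<Longrightarrow> set_pmf (glauber_dist a b c n \<beta> t x) \<subseteq> states n \<beta>"
proof (induction t)
  case (Suc t)
  then show ?case using glauber_step_closed by (force simp: glauber_dist_def)
qed (simp add: glauber_dist_def)

lemma pmf_glauber_dist_Suc: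
  assumes x: "x \<in> states n \<beta>"
  shows "pmf (glauber_dist a b c n \<beta> (Suc t) x) y =
    (\<Sum>z \<in> states n \<beta>. pmf (glauber_dist a b c n \<beta> t x) z * kern z y)"
proof -
  have "pmf (glauber_dist a b c n \<beta> (Suc t) x) y =
      measure_pmf.expectation (glauber_dist a b c n \<beta> t x) (\<lambda>z. kern z y)"
    by (simp add: glauber_dist_def pmf_bind)
  also have "\<dots> = (\<Sum>z \<in> states n \<beta>. kern z y * pmf (glauber_dist a b c n \<beta> t x) z)"
    by (rule integral_measure_pmf_real) (use glauber_dist_closed[OF x] in auto)
  finally show ?thesis by (simp add: mult.commute)
qed

text \<open>
  The chain started from the Boltzmann measure restricted to \<open>S\<close> stays dominated by the Boltzmann
  measure, so that at each step at most the mass of the inner boundary of \<open>S\<close> leaks out.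
\<close>

lemma bottleneck_bound:
  assumes S: "S \<subseteq> states n \<beta>" "S \<noteq> {}"
    and half: "sum (weight a b c n) S \<le> sum (weight a b c n) (states n \<beta> - S)"
    and mix: "(MAX x \<in> states n \<beta>.
        tv_dist (states n \<beta>) (pmf (glauber_dist a b c n \<beta> t x)) (boltzmann a b c n \<beta>)) \<le> 1 / 4"
  shows "sum (weight a b c n) S / 4 \<le>
    real t * sum (weight a b c n) {x \<in> S. \<exists>q \<in> cells n. directed_cycle x q \<and> reverse_cell x q \<notin> S}"
proof -
  let ?\<Omega> = "states n \<beta>"
  let ?w = "weight a b c n"
  define B where "B = {x \<in> S. \<exists>q \<in> cells n. directed_cycle x q \<and> reverse_cell x q \<notin> S}"
  \<comment> \<open>The law at time \<open>t\<close> of the chain started from the weights on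
    \<open>S\<close>, left unnormalised so that it can be compared with \<open>weight\<close>
    directly.\<close>
  define \<mu> where "\<mu> t y = (\<Sum>x \<in> S. ?w x * pmf (glauber_dist a b c n \<beta> t x) y)" for t y
  have wp: "?w z > 0" for z using abc weight_pos by auto
  have finS: "finite S" using S finite_subset finite_states by blast
  have \<mu>_nonneg: "\<mu> t y \<ge> 0" for t y
    unfolding \<mu>_def by (rule sum_nonneg) (use wp in \<open>simp add: less_imp_le\<close>)
  have \<mu>_Suc: "\<mu> (Suc t) y = (\<Sum>z \<in> ?\<Omega>. \<mu> t z * kern z y)" for t y
  proof -
    have "\<mu> (Suc t) y = (\<Sum>x \<in> S. ?w x * (\<Sum>z \<in> ?\<Omega>. pmf (glauber_dist a b c n \<beta> t x) z * kern z y))"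
      unfolding \<mu>_def by (rule sum.cong) (use S pmf_glauber_dist_Suc in auto)
    also have "\<dots> = (\<Sum>z \<in> ?\<Omega>. \<mu> t z * kern z y)"
      unfolding \<mu>_def sum_distrib_left sum_distrib_right
      by (subst sum.swap) (simp add: mult.assoc)
    finally show ?thesis .
  qed
  have \<mu>_0: "\<mu> 0 y = (if y \<in> S then ?w y else 0)" for y
    unfolding \<mu>_def by (simp add: glauber_dist_def indicator_def finS if_distrib cong: if_cong)
  have \<mu>_le: "y \<in> ?\<Omega> \<Longrightarrow> \<mu> t y \<le> ?w y" for t y
  proof (induction t arbitrary: y)
    case (Suc t)
    have "\<mu> (Suc t) y \<le> (\<Sum>z \<in> ?\<Omega>. ?w z * kern z y)"
      unfolding \<mu>_Suc by (intro sum_mono mult_right_mono Suc.IH) auto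
    then show ?case using weight_stationary[OF Suc.prems] by simp
  qed (use wp in \<open>simp add: \<mu>_0 less_imp_le\<close>)
  have leak: "(\<Sum>y \<in> ?\<Omega> - S. \<mu> t y) \<le> real t * sum ?w B" for t
  proof (induction t)
    case (Suc t)
    have "(\<Sum>y \<in> ?\<Omega> - S. \<mu> (Suc t) y) = (\<Sum>z \<in> ?\<Omega>. \<mu> t z * (\<Sum>y \<in> ?\<Omega> - S. kern z y))"
      unfolding \<mu>_Suc by (subst sum.swap) (simp add: sum_distrib_left)
    also have "\<dots> \<le> (\<Sum>z \<in> ?\<Omega>. (if z \<in> ?\<Omega> - S then \<mu> t z else 0) + (if z \<in> B then ?w z else 0))"
    proof (rule sum_mono)
      fix z assume z: "z \<in> ?\<Omega>"
      have le1: "(\<Sum>y \<in> ?\<Omega> - S. kern z y) \<le> 1"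
        using sum_mono2[of ?\<Omega> "?\<Omega> - S" "kern z"] sum_kern[OF z] by auto
      have le: "\<mu> t z * (\<Sum>y \<in> ?\<Omega> - S. kern z y) \<le> \<mu> t z"
        using mult_left_mono[OF le1 \<mu>_nonneg[of t z]] by simp
      show "\<mu> t z * (\<Sum>y \<in> ?\<Omega> - S. kern z y) \<le>
          (if z \<in> ?\<Omega> - S then \<mu> t z else 0) + (if z \<in> B then ?w z else 0)"
      \<comment> \<open>Mass outside \<open>S\<close> is counted already, a state of
        \<open>B\<close> releases at most its own weight in one step, and any other state of
        \<open>S\<close> cannot leave \<open>S\<close> in one step.\<close>
      proof (cases "z \<in> S \<and> z \<notin> B")
        case True
        have "kern z y = 0" if "y \<in> ?\<Omega> - S" for y
          using set_pmf_glauber_step[OF z, of y] True that by (auto simp: B_def pmf_eq_0_set_pmf)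
        then show ?thesis using True by simp
      qed (use le \<mu>_le[OF z, of t] z \<mu>_nonneg[of t z] wp[of z] in \<open>auto simp: B_def\<close>)
    qed
    also have "\<dots> = (\<Sum>y \<in> ?\<Omega> - S. \<mu> t y) + sum ?w B"
    proof -
      have "?\<Omega> \<inter> B = B" using S by (auto simp: B_def)
      moreover have "?\<Omega> \<inter> (?\<Omega> - S) = ?\<Omega> - S" by auto
      ultimately show ?thesis
        unfolding sum.distrib
        by (simp only: sum.If_cases[OF finite_states] Collect_mem_eq sum.neutral_const add_0_right)
    qed
    also have "\<dots> \<le> real (Suc t) * sum ?w B" using Suc by (simp add: algebra_simps)
    finally show ?case .
  qed (simp add: \<mu>_0)
  define Z where "Z = sum ?w ?\<Omega>"
  have Z: "Z = sum ?w S + sum ?w (?\<Omega> - S)"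
    unfolding Z_def using S sum.subset_diff[OF S(1) finite_states, of ?w] by simp
  have wS: "sum ?w S > 0" by (rule sum_pos) (use finS S wp in auto)
  have Zp: "Z > 0" using Z wS half by simp
  \<comment> \<open>Both laws have total mass 1, so a deficit of the complement of \<open>S\<close>
    is matched by an excess on \<open>S\<close>. The deficit is thus at most the total variation
    distance 1/4, while the complement has stationary mass at least 1/2.\<close>
  have escape: "(\<Sum>y \<in> ?\<Omega> - S. pmf (glauber_dist a b c n \<beta> t x) y) \<ge> 1 / 4" if x: "x \<in> S" for x
  proof -
    let ?P = "pmf (glauber_dist a b c n \<beta> t x)"
    let ?\<pi> = "boltzmann a b c n \<beta>"
    have x\<Omega>: "x \<in> ?\<Omega>" using x S by auto
    have "tv_dist ?\<Omega> ?P ?\<pi> \<le> 1 / 4"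
      by (rule order_trans[OF Max_ge mix]) (use x\<Omega> in auto)
    then have tv: "(\<Sum>y \<in> ?\<Omega>. \<bar>?P y - ?\<pi> y\<bar>) \<le> 1 / 2" by (simp add: tv_dist_def)
    have P1: "(\<Sum>y \<in> ?\<Omega>. ?P y) = 1" by (rule sum_pmf_eq_1) (use glauber_dist_closed x\<Omega> in auto)
    have \<pi>1: "(\<Sum>y \<in> ?\<Omega>. ?\<pi> y) = 1" using Zp by (simp add: boltzmann_def Z_def flip: sum_divide_distrib)
    have \<pi>half: "(\<Sum>y \<in> ?\<Omega> - S. ?\<pi> y) \<ge> 1 / 2"
      using half Z Zp by (simp add: boltzmann_def Z_def[symmetric] field_simps flip: sum_divide_distrib)
    have split: "sum f ?\<Omega> = sum f (?\<Omega> - S) + sum f S" for f :: "_ \<Rightarrow> real"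
      by (rule sum.subset_diff) (use S in auto)
    have "(\<Sum>y \<in> ?\<Omega> - S. ?\<pi> y - ?P y) \<le> (\<Sum>y \<in> ?\<Omega> - S. \<bar>?P y - ?\<pi> y\<bar>)" by (rule sum_mono) auto
    moreover have "(\<Sum>y \<in> S. ?P y - ?\<pi> y) \<le> (\<Sum>y \<in> S. \<bar>?P y - ?\<pi> y\<bar>)" by (rule sum_mono) auto
    ultimately show ?thesis
      using tv P1 \<pi>1 \<pi>half unfolding split sum_subtractf by linarith
  qed
  have "sum ?w S / 4 = (\<Sum>x \<in> S. ?w x * (1 / 4))" by (simp add: sum_divide_distrib)
  also have "\<dots> \<le> (\<Sum>x \<in> S. ?w x * (\<Sum>y \<in> ?\<Omega> - S. pmf (glauber_dist a b c n \<beta> t x) y))"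
    by (intro sum_mono mult_left_mono escape) (use wp in \<open>auto simp: less_imp_le\<close>)
  also have "\<dots> = (\<Sum>y \<in> ?\<Omega> - S. \<mu> t y)"
    unfolding \<mu>_def sum_distrib_left by (rule sum.swap)
  also have "\<dots> \<le> real t * sum ?w B" by (rule leak)
  finally show ?thesis unfolding B_def .
qed

end

text \<open>Only ratios of weights enter, with no normalising constant, so the notion is easily
  carried over by the reflection. The third set is the inner boundary of \<open>S\<close>, the only
  place from which mass leaks.\<close>

definition bottleneck ::
  "real \<Rightarrow> real \<Rightarrow> real \<Rightarrow> nat \<Rightarrow> orientation \<Rightarrow> real \<Rightarrow> orientation set \<Rightarrow> bool" where
  "bottleneck a b c n \<beta> \<epsilon> S \<longleftrightarrow> S \<subseteq> states n \<beta> \<and> S \<noteq> {} \<and>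
     sum (weight a b c n) S \<le> sum (weight a b c n) (states n \<beta> - S) \<and>
     sum (weight a b c n) {x \<in> S. \<exists>q \<in> cells n. directed_cycle x q \<and> reverse_cell x q \<notin> S}
       \<le> \<epsilon> * sum (weight a b c n) S"

lemma mixing_time_ge:
  assumes abc: "0 < a" "0 < b" "0 < c" and \<epsilon>: "0 < \<epsilon>" and S: "bottleneck a b c n \<beta> \<epsilon> S"
  shows "ereal (1 / (4 * \<epsilon>)) \<le> ereal_of_enat (mixing_time a b c n \<beta> (1 / 4))"
proof -
  have t: "1 / (4 * \<epsilon>) \<le> real t" if mix: "(MAX x \<in> states n \<beta>.
        tv_dist (states n \<beta>) (pmf (glauber_dist a b c n \<beta> t x)) (boltzmann a b c n \<beta>)) \<le> 1 / 4" for t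
  proof -
    let ?w = "sum (weight a b c n) S"
    have "finite S" using S finite_subset[OF _ finite_states] by (auto simp: bottleneck_def)
    then have "0 < ?w" by (intro sum_pos) (use S weight_pos abc in \<open>auto simp: bottleneck_def\<close>)
    have "?w / 4 \<le> real t * sum (weight a b c n) {x \<in> S. \<exists>q \<in> cells n. directed_cycle x q \<and> reverse_cell x q \<notin> S}"
      by (rule bottleneck_bound[OF abc]) (use S mix in \<open>auto simp: bottleneck_def\<close>)
    also have "\<dots> \<le> real t * (\<epsilon> * ?w)"
      using S by (intro mult_left_mono) (auto simp: bottleneck_def)
    finally have "?w * (1 / 4) \<le> ?w * (real t * \<epsilon>)" by (simp add: algebra_simps)
    then have "1 / 4 \<le> real t * \<epsilon>" using \<open>0 < ?w\<close> by simp
    then show ?thesis using \<epsilon> by (simp add: field_simps)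
  qed
  define A where "A = {enat t | t. (MAX x \<in> states n \<beta>.
        tv_dist (states n \<beta>) (pmf (glauber_dist a b c n \<beta> t x)) (boltzmann a b c n \<beta>)) \<le> 1 / 4}"
  have m: "mixing_time a b c n \<beta> (1 / 4) = Inf A" by (simp add: mixing_time_def A_def)
  show ?thesis
  proof (cases "A = {}")
    \<comment> \<open>No time meets the threshold; the infimum over the empty set is
      infinite.\<close>
    case True
    then show ?thesis by (simp add: m Inf_enat_def)
  next
    case False
    then have "Inf A \<in> A" unfolding Inf_enat_def using LeastI_ex[of "\<lambda>x. x \<in> A"] by auto
    then obtain s where "Inf A = enat s" "1 / (4 * \<epsilon>) \<le> real s" using t by (auto simp: A_def)
    then show ?thesis by (simp add: m)
  qed
qed

section \<open>Persistent walks\<close>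

text \<open>
  A walk is a list of steps, \<open>True\<close> for \<open>+1\<close> and \<open>False\<close> for \<open>-1\<close>; a step is repeated with
  probability \<open>p\<close> and changed with probability \<open>q\<close>.
\<close>

fun walk_wt :: "real \<Rightarrow> real \<Rightarrow> bool list \<Rightarrow> real" where
  "walk_wt p q (x # y # ts) = (if x = y then p else q) * walk_wt p q (y # ts)"
| "walk_wt p q _ = 1"

definition disp :: "bool list \<Rightarrow> int" where
  "disp ts = (\<Sum>x\<leftarrow>ts. if x then 1 else - 1)"

lemma disp_simps [simp]:
  "disp [] = 0" "disp (x # ts) = (if x then 1 else - 1) + disp ts" "disp (ts @ us) = disp ts + disp us"
  "disp (map Not ts) = - disp ts" "disp (rev ts) = disp ts"
proof -
  show "disp (map Not ts) = - disp ts" by (induction ts) (auto simp: disp_def)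
qed (auto simp: disp_def rev_map[symmetric])

lemma abs_disp_le: "\<bar>disp ts\<bar> \<le> int (length ts)"
  by (induction ts) (auto simp: abs_if split: if_splits)

lemma walk_wt_append:
  "us \<noteq> [] \<Longrightarrow> vs \<noteq> [] \<Longrightarrow>
    walk_wt p q (us @ vs) = walk_wt p q us * (if last us = hd vs then p else q) * walk_wt p q vs"
proof (induction p q us rule: walk_wt.induct)
  case ("2_2" p q v)
  then show ?case by (cases vs) auto
qed auto

lemma walk_wt_map_Not: "walk_wt p q (map Not ts) = walk_wt p q ts"
  by (induction p q ts rule: walk_wt.induct) auto

lemma walk_wt_rev: "walk_wt p q (rev ts) = walk_wt p q ts"
proof (induction p q ts rule: walk_wt.induct)
  case (1 p q x y ts)
  have "walk_wt p q (rev (x # y # ts)) = walk_wt p q (rev (y # ts) @ [x])" by simp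
  also have "\<dots> = walk_wt p q (rev (y # ts)) * (if y = x then p else q)"
    by (subst walk_wt_append) auto
  also have "\<dots> = walk_wt p q (x # y # ts)" using 1 by auto
  finally show ?case .
qed auto

abbreviation bool_lists :: "nat \<Rightarrow> bool list set" where
  "bool_lists L \<equiv> {ts. length ts = L}"

lemma finite_bool_lists [simp]: "finite (bool_lists L)"
  using finite_lists_length_eq[of "UNIV :: bool set" L] by simp

lemma sum_bool_lists_Suc:
  fixes f :: "bool list \<Rightarrow> real"
  shows "sum f (bool_lists (Suc L)) = (\<Sum>ts \<in> bool_lists L. f (True # ts) + f (False # ts))"
proof -
  have "bool_lists (Suc L) = Cons True ` bool_lists L \<union> Cons False ` bool_lists L"
    by (auto simp: length_Suc_conv)
  moreover have "Cons True ` bool_lists L \<inter> Cons False ` bool_lists L = {}" by auto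
  ultimately show ?thesis
    by (simp add: sum.union_disjoint sum.reindex sum.distrib)
qed

lemma exp_le_quadratic:
  fixes y :: real
  assumes "\<bar>y\<bar> \<le> 1"
  shows "exp y \<le> 1 + y + y\<^sup>2"
proof (cases "0 \<le> y")
  case False
  define z where "z = - y"
  have z: "z > 0" "z \<le> 1" using False assms by (auto simp: z_def)
  have "exp z \<ge> 1 + z" by simp
  then have "exp (- z) \<le> 1 / (1 + z)"
    using z by (simp add: exp_minus field_simps)
  \<comment> \<open>Because \<open>(1 + z) * (1 - z + z^2) = 1 + z^3\<close>, which is at least
    1.\<close>
  also have "\<dots> \<le> 1 - z + z\<^sup>2"
    using z by (simp add: field_simps power2_eq_square)
  finally show ?thesis by (simp add: z_def)
qed (use exp_bound assms in auto)

lemma sum_UN_le: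
  fixes f :: "'a \<Rightarrow> real"
  assumes "finite I" "\<And>i. finite (A i)" "\<And>x. 0 \<le> f x"
  shows "sum f (\<Union>i \<in> I. A i) \<le> (\<Sum>i \<in> I. sum f (A i))"
  using assms(1)
proof induction
  case (insert i I)
  have "sum f (A i \<union> (\<Union>i \<in> I. A i)) \<le> sum f (A i) + sum f (\<Union>i \<in> I. A i)"
    using insert(1) assms(2,3) by (subst sum_Un) (auto intro!: sum_nonneg)
  then show ?case using insert by simp
qed simp

section \<open>Exponential moments and deviations of the persistent walk\<close>

context
  fixes p q :: real
  assumes pq: "0 < p" "0 < q" "p + q = 1"
begin

lemma walk_wt_pos: "0 < walk_wt p q ts"
  using pq by (induction p q ts rule: walk_wt.induct) auto

text \<open>The first step carries no factor in \<open>walk_wt\<close>, so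
  \<open>walk_wt p q (x # ts)\<close> is the conditional law of \<open>ts\<close> given the first
  step \<open>x\<close>. The later steps sum out to 1.\<close>

lemma walk_wt_marginal:
  fixes g :: "bool list \<Rightarrow> real"
  shows "(\<Sum>ts \<in> bool_lists (L + M). walk_wt p q (x # ts) * g (take L ts)) =
   (\<Sum>ts \<in> bool_lists L. walk_wt p q (x # ts) * g ts)"
proof (induction L arbitrary: x g)
  case 0
  have "(\<Sum>ts \<in> bool_lists M. walk_wt p q (x # ts)) = 1" for x
  proof (induction M arbitrary: x)
    case (Suc M)
    then show ?case using pq
      by (cases x) (simp_all add: sum_bool_lists_Suc sum.distrib flip: sum_distrib_left)
  qed simp
  then show ?case by (simp flip: sum_distrib_right)
next
  case (Suc L)
  have "(\<Sum>ts \<in> bool_lists (L + M). walk_wt p q (x # y # ts) * g (y # take L ts)) =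
      (\<Sum>ts \<in> bool_lists L. walk_wt p q (x # y # ts) * g (y # ts))" for y
    using arg_cong[OF Suc.IH[of y "\<lambda>ts. g (y # ts)"], of "\<lambda>s. (if x = y then p else q) * s"]
    by (simp add: sum_distrib_left mult.assoc)
  from this[of True] this[of False] show ?case by (simp add: sum_bool_lists_Suc sum.distrib)
qed

lemma walk_wt_sum: "(\<Sum>ts \<in> bool_lists L. walk_wt p q (x # ts)) = 1"
  using walk_wt_marginal[where L = 0 and g = "\<lambda>_. 1"] by simp

text \<open>
  The factors \<open>exp (\<plusminus> (p / q - 1) / 2 * \<eta>)\<close> attached to the current step cancel the terms of first
  order in \<open>\<eta>\<close> of the tilted transition matrix.
\<close>

lemma walk_wt_exp_moment:
  assumes \<eta>: "\<bar>\<eta>\<bar> \<le> 1" "p / q * \<bar>\<eta>\<bar> \<le> 1"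
  shows "(\<Sum>ts \<in> bool_lists L. walk_wt p q (x # ts) * exp (\<eta> * disp ts)) \<le>
    exp (1 + p / q + p / q * \<eta>\<^sup>2 * real L)"
proof -
  define \<rho> where "\<rho> = p / q"
  define h where "h x = exp ((if x then 1 else - 1) * (\<rho> - 1) / 2 * \<eta>)" for x
  \<comment> \<open>A common bound for \<open>h x\<close> and its inverse. Entering and leaving the
    \<open>h\<close>-weighted induction costs \<open>M\<close> each, which produces the prefactor
    \<open>exp (1 + p / q)\<close>.\<close>
  define M where "M = exp ((1 + \<rho>) / 2)"
  have \<rho>: "\<rho> > 0" "q * \<rho> = p" "p + q * \<rho>\<^sup>2 = \<rho>" 
    using pq distrib_left[of p p q] by (auto simp: \<rho>_def field_simps power2_eq_square)
  have abs: "\<bar>(if x then 1 else - 1) * (\<rho> - 1) / 2 * \<eta>\<bar> \<le> (1 + \<rho>) / 2" for x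
  proof -
    have "\<bar>(if x then 1 else - 1) * (\<rho> - 1) / 2 * \<eta>\<bar> = \<bar>\<rho> - 1\<bar> / 2 * \<bar>\<eta>\<bar>"
      by (simp add: abs_mult)
    also have "\<dots> \<le> (1 + \<rho>) / 2 * 1"
      by (rule mult_mono) (use \<eta> \<rho> in auto)
    finally show ?thesis by simp
  qed
  have h_le: "h x \<le> M" for x
    using abs[of x] by (auto simp: h_def M_def)
  have h_ge: "1 \<le> M * h x" for x
    using abs[of x] unfolding h_def M_def exp_add[symmetric] one_le_exp_iff by linarith
  \<comment> \<open>With mean zero, since \<open>p = q * \<rho>\<close>, the linear terms cancel;
    the quadratic ones add up to \<open>\<rho> * \<eta>\<^sup>2\<close>. The two signs of
    \<open>\<epsilon>\<close> serve the two current steps.\<close>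
  have e1: "p * exp \<epsilon> + q * exp (- \<rho> * \<epsilon>) \<le> exp (\<rho> * \<eta>\<^sup>2)" if "\<epsilon> = \<eta> \<or> \<epsilon> = - \<eta>" for \<epsilon>
  proof -
    have "\<rho> * \<bar>\<eta>\<bar> \<le> 1" using \<eta> by (simp add: \<rho>_def)
    then have "\<bar>\<epsilon>\<bar> \<le> 1" "\<bar>- \<rho> * \<epsilon>\<bar> \<le> 1" "\<epsilon>\<^sup>2 = \<eta>\<^sup>2"
      using that \<eta>(1) \<rho>(1) by (auto simp: abs_mult)
    then have "p * exp \<epsilon> + q * exp (- \<rho> * \<epsilon>) \<le> p * (1 + \<epsilon> + \<epsilon>\<^sup>2) + q * (1 + (- \<rho> * \<epsilon>) + (- \<rho> * \<epsilon>)\<^sup>2)"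
      using pq by (intro add_mono mult_left_mono exp_le_quadratic) auto
    also have "\<dots> = (p + q) + (p - q * \<rho>) * \<epsilon> + (p + q * \<rho>\<^sup>2) * \<epsilon>\<^sup>2"
      by (simp add: algebra_simps power2_eq_square)
    also have "\<dots> = 1 + \<rho> * \<eta>\<^sup>2" using \<rho> pq \<open>\<epsilon>\<^sup>2 = \<eta>\<^sup>2\<close> by simp
    also have "\<dots> \<le> exp (\<rho> * \<eta>\<^sup>2)" by simp
    finally show ?thesis .
  qed
  have step: "p * exp \<eta> * h True + q * exp (- \<eta>) * h False \<le> exp (\<rho> * \<eta>\<^sup>2) * h True"
    "p * exp (- \<eta>) * h False + q * exp \<eta> * h True \<le> exp (\<rho> * \<eta>\<^sup>2) * h False"
  proof -
    \<comment> \<open>The ratio of the two values of \<open>h\<close> turns the exponent of a change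
      of direction from \<open>\<eta>\<close> into \<open>\<rho> * \<eta>\<close> in absolute value,
      as \<open>e1\<close> requires.\<close>
    have hTF: "exp (- \<eta>) * h False = exp (- \<rho> * \<eta>) * h True" "exp \<eta> * h True = exp (- \<rho> * - \<eta>) * h False"
      by (simp_all add: h_def field_simps flip: exp_add)
    have "p * exp \<eta> * h True + q * exp (- \<eta>) * h False = (p * exp \<eta> + q * exp (- \<rho> * \<eta>)) * h True"
      using hTF by (simp add: algebra_simps)
    also have "\<dots> \<le> exp (\<rho> * \<eta>\<^sup>2) * h True"
      by (intro mult_right_mono e1) (auto simp: h_def)
    finally show "p * exp \<eta> * h True + q * exp (- \<eta>) * h False \<le> exp (\<rho> * \<eta>\<^sup>2) * h True" .
    have "p * exp (- \<eta>) * h False + q * exp \<eta> * h True = (p * exp (- \<eta>) + q * exp (- \<rho> * - \<eta>)) * h False"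
      using hTF by (simp add: algebra_simps)
    also have "\<dots> \<le> exp (\<rho> * \<eta>\<^sup>2) * h False"
      by (intro mult_right_mono e1) (auto simp: h_def)
    finally show "p * exp (- \<eta>) * h False + q * exp \<eta> * h True \<le> exp (\<rho> * \<eta>\<^sup>2) * h False" .
  qed
  have main: "(\<Sum>ts \<in> bool_lists L. walk_wt p q (x # ts) * exp (\<eta> * disp ts)) \<le>
      M * exp (\<rho> * \<eta>\<^sup>2 * L) * h x" for x
  proof (induction L arbitrary: x)
    case 0
    then show ?case using h_ge[of x] by simp
  next
    case (Suc L)
    define F where "F y = (\<Sum>ts \<in> bool_lists L. walk_wt p q (y # ts) * exp (\<eta> * disp ts))" for y
    define E where "E = M * exp (\<rho> * \<eta>\<^sup>2 * L)"
    have E: "E > 0" by (simp add: E_def M_def)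
    have F: "F y \<le> E * h y" for y using Suc by (simp add: F_def E_def)
    have "(\<Sum>ts \<in> bool_lists (Suc L). walk_wt p q (x # ts) * exp (\<eta> * disp ts)) =
        (if x then p else q) * exp \<eta> * F True + (if x then q else p) * exp (- \<eta>) * F False"
      unfolding F_def sum_distrib_left sum_bool_lists_Suc sum.distrib[symmetric]
      by (rule sum.cong) (auto simp: distrib_left right_diff_distrib exp_add exp_diff exp_minus field_simps)
    also have "\<dots> \<le> (if x then p else q) * exp \<eta> * (E * h True) + (if x then q else p) * exp (- \<eta>) * (E * h False)"
      by (intro add_mono mult_left_mono F) (use pq in auto)
    also have "\<dots> = E * (if x then p * exp \<eta> * h True + q * exp (- \<eta>) * h False
        else p * exp (- \<eta>) * h False + q * exp \<eta> * h True)"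
      by (simp add: algebra_simps)
    also have "\<dots> \<le> E * (exp (\<rho> * \<eta>\<^sup>2) * h x)"
      using step E by (intro mult_left_mono) auto
    also have "\<dots> = M * exp (\<rho> * \<eta>\<^sup>2 * Suc L) * h x"
      by (simp add: E_def algebra_simps exp_add)
    finally show ?case .
  qed
  have "M * exp (\<rho> * \<eta>\<^sup>2 * L) * h x \<le> M * exp (\<rho> * \<eta>\<^sup>2 * L) * M"
    by (intro mult_left_mono h_le) (auto simp: M_def)
  also have "\<dots> = exp (1 + \<rho> + \<rho> * \<eta>\<^sup>2 * L)"
    by (simp add: M_def field_simps flip: exp_add)
  finally show ?thesis using main[of x] by (simp add: \<rho>_def)
qed

text \<open>Markov's inequality for the tilts \<open>\<eta>\<close> and \<open>- \<eta>\<close>; the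
  two tails give the factor 2.\<close>

lemma walk_wt_deviation:
  assumes \<eta>: "0 < \<eta>" "\<eta> \<le> 1" "p / q * \<eta> \<le> 1"
  shows "(\<Sum>ts | length ts = L \<and> R \<le> \<bar>disp ts\<bar>. walk_wt p q (x # ts)) \<le>
    2 * exp (1 + p / q + p / q * \<eta>\<^sup>2 * real L - \<eta> * R)"
proof -
  have "(\<Sum>ts | length ts = L \<and> R \<le> \<bar>disp ts\<bar>. walk_wt p q (x # ts)) \<le>
      (\<Sum>ts | length ts = L \<and> R \<le> \<bar>disp ts\<bar>.
        walk_wt p q (x # ts) * exp (\<eta> * disp ts) * exp (- \<eta> * R) +
        walk_wt p q (x # ts) * exp ((- \<eta>) * disp ts) * exp (- \<eta> * R))"
  proof (rule sum_mono)
    fix ts assume "ts \<in> {ts. length ts = L \<and> R \<le> \<bar>disp ts\<bar>}"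
    then have "R \<le> disp ts \<or> R \<le> - disp ts" by auto
    then have "1 \<le> exp (\<eta> * disp ts) * exp (- \<eta> * R) \<or> 1 \<le> exp ((- \<eta>) * disp ts) * exp (- \<eta> * R)"
    proof
      assume "R \<le> disp ts"
      then have "\<eta> * R \<le> \<eta> * disp ts" using \<eta> by (intro mult_left_mono) auto
      then show ?thesis by (simp flip: exp_add)
    next
      assume "R \<le> - disp ts"
      then have "\<eta> * R \<le> \<eta> * of_int (- disp ts)" using \<eta> by (intro mult_left_mono) linarith+
      then show ?thesis by (simp flip: exp_add)
    qed
    then have "1 \<le> exp (\<eta> * disp ts) * exp (- \<eta> * R) + exp ((- \<eta>) * disp ts) * exp (- \<eta> * R)"
      by (smt (verit) exp_gt_zero mult_pos_pos)
    then have "walk_wt p q (x # ts) * 1 \<le> walk_wt p q (x # ts) *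
        (exp (\<eta> * disp ts) * exp (- \<eta> * R) + exp ((- \<eta>) * disp ts) * exp (- \<eta> * R))"
      using walk_wt_pos[of "x # ts"] by (intro mult_left_mono) auto
    then show "walk_wt p q (x # ts) \<le> walk_wt p q (x # ts) * exp (\<eta> * disp ts) * exp (- \<eta> * R) +
        walk_wt p q (x # ts) * exp ((- \<eta>) * disp ts) * exp (- \<eta> * R)"
      by (simp add: algebra_simps)
  qed
  also have "\<dots> \<le> (\<Sum>ts \<in> bool_lists L.
        walk_wt p q (x # ts) * exp (\<eta> * disp ts) * exp (- \<eta> * R) +
        walk_wt p q (x # ts) * exp ((- \<eta>) * disp ts) * exp (- \<eta> * R))"
    by (rule sum_mono2) (auto intro!: add_nonneg_nonneg mult_nonneg_nonneg less_imp_le[OF walk_wt_pos])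
  also have "\<dots> = (\<Sum>ts \<in> bool_lists L. walk_wt p q (x # ts) * exp (\<eta> * disp ts)) * exp (- \<eta> * R) +
      (\<Sum>ts \<in> bool_lists L. walk_wt p q (x # ts) * exp ((- \<eta>) * disp ts)) * exp (- \<eta> * R)"
    by (simp add: sum.distrib sum_distrib_right)
  also have "\<dots> \<le> exp (1 + p / q + p / q * \<eta>\<^sup>2 * real L) * exp (- \<eta> * R) +
      exp (1 + p / q + p / q * (- \<eta>)\<^sup>2 * real L) * exp (- \<eta> * R)"
    by (intro add_mono mult_right_mono walk_wt_exp_moment) (use \<eta> in auto)
  also have "\<dots> = 2 * exp (1 + p / q + p / q * \<eta>\<^sup>2 * real L - \<eta> * R)"
    by (simp add: exp_diff exp_minus field_simps)
  finally show ?thesis .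
qed

text \<open>A union bound over the times \<open>s\<close>, each reduced by
  \<open>walk_wt_marginal\<close> to a walk of length \<open>s\<close>. The extra factor is linear
  in \<open>L\<close>, which the final estimate can afford.\<close>

lemma walk_wt_max_deviation:
  assumes \<eta>: "0 < \<eta>" "\<eta> \<le> 1" "p / q * \<eta> \<le> 1"
  shows "(\<Sum>ts | length ts = L \<and> (\<exists>s \<le> L. R \<le> \<bar>disp (take s ts)\<bar>). walk_wt p q (x # ts)) \<le>
    2 * real (Suc L) * exp (1 + p / q + p / q * \<eta>\<^sup>2 * real L - \<eta> * R)"
proof -
  let ?A = "\<lambda>s. {ts. length ts = L \<and> R \<le> \<bar>disp (take s ts)\<bar>}"
  let ?B = "exp (1 + p / q + p / q * \<eta>\<^sup>2 * real L - \<eta> * R)"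
  have fin: "finite (?A s)" for s by (rule finite_subset[OF _ finite_bool_lists[of L]]) auto
  have "{ts. length ts = L \<and> (\<exists>s \<le> L. R \<le> \<bar>disp (take s ts)\<bar>)} = (\<Union>s \<in> {..L}. ?A s)" by auto
  then have "(\<Sum>ts | length ts = L \<and> (\<exists>s \<le> L. R \<le> \<bar>disp (take s ts)\<bar>). walk_wt p q (x # ts)) \<le>
      (\<Sum>s \<in> {..L}. \<Sum>ts \<in> ?A s. walk_wt p q (x # ts))"
    using sum_UN_le[of "{..L}" ?A "\<lambda>ts. walk_wt p q (x # ts)"] fin walk_wt_pos
    by (simp add: less_imp_le)
  also have "\<dots> \<le> (\<Sum>s \<in> {..L}. 2 * ?B)"
  proof (rule sum_mono)
    fix s assume "s \<in> {..L}"
    then obtain M where M: "L = s + M" by (auto simp: le_iff_add)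
    have "(\<Sum>ts \<in> ?A s. walk_wt p q (x # ts)) =
        (\<Sum>ts \<in> bool_lists L. walk_wt p q (x # ts) * (if R \<le> \<bar>disp (take s ts)\<bar> then 1 else 0))"
      by (intro sum.mono_neutral_cong_left) auto
    also have "\<dots> = (\<Sum>ts \<in> bool_lists s. walk_wt p q (x # ts) * (if R \<le> \<bar>disp ts\<bar> then 1 else 0))"
      unfolding M by (rule walk_wt_marginal)
    also have "\<dots> = (\<Sum>ts | length ts = s \<and> R \<le> \<bar>disp ts\<bar>. walk_wt p q (x # ts))"
      by (intro sum.mono_neutral_cong_right) auto
    also have "\<dots> \<le> 2 * exp (1 + p / q + p / q * \<eta>\<^sup>2 * real s - \<eta> * R)"
      by (rule walk_wt_deviation[OF \<eta>])
    also have "\<dots> \<le> 2 * ?B" using pq M by (auto intro!: divide_right_mono mult_left_mono)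
    finally show "(\<Sum>ts \<in> ?A s. walk_wt p q (x # ts)) \<le> 2 * ?B" .
  qed
  also have "\<dots> = 2 * real (Suc L) * ?B" by simp
  finally show ?thesis .
qed

end

text \<open>The path enters by a vertical edge at the top and leaves by a horizontal edge on the
  left, which fixes the first step as down and the last as left. Between them it goes
  \<open>m\<close> times left and \<open>m\<close> times down, hence the length and the zero
  displacement.\<close>

definition tube_walks :: "nat \<Rightarrow> int \<Rightarrow> bool list set" where
  "tube_walks m r = {ts. length ts = 2 * m \<and> \<not> hd ts \<and> last ts \<and> disp ts = 0 \<and>
     (\<forall>t \<le> 2 * m. \<bar>disp (take t ts)\<bar> \<le> r)}"

lemma finite_tube_walks [simp]: "finite (tube_walks m r)"
  by (rule finite_subset[OF _ finite_bool_lists[of "2 * m"]]) (auto simp: tube_walks_def)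

lemma disp_take_Cons:
  "\<bar>disp (take t (x # ts))\<bar> \<le> 1 + \<bar>disp (take (t - 1) ts)\<bar>"
  by (cases t) auto

text \<open>The second half retraces \<open>v\<close> from its end back to 0: reversing the list and
  flipping every step makes its positions those of the prefixes of \<open>v\<close>, so it stays in
  the tube. The initial down step of \<open>v\<close> becomes the final left step.\<close>

lemma tube_walks_glue:
  assumes u: "length u = m" "\<not> hd u" "\<forall>t \<le> m. \<bar>disp (take t u)\<bar> \<le> r"
    and v: "length v = m" "\<not> hd v" "\<forall>t \<le> m. \<bar>disp (take t v)\<bar> \<le> r"
    and uv: "disp u = disp v" and m: "0 < m"
  shows "u @ rev (map Not v) \<in> tube_walks m r"
proof -
  have ne: "u \<noteq> []" "v \<noteq> []" using u v m by auto
  have "\<bar>disp (take t (u @ rev (map Not v)))\<bar> \<le> r" if t: "t \<le> 2 * m" for t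
  proof (cases "t \<le> m")
    case False
    define s where "s = t - m"
    have s: "s \<le> m" using t by (simp add: s_def)
    have "disp v = disp (take (m - s) v) + disp (drop (m - s) v)"
      by (metis append_take_drop_id disp_simps(3))
    moreover have "take s (rev (map Not v)) = rev (map Not (drop (m - s) v))"
      using s v(1) by (simp add: take_rev drop_map)
    ultimately have "disp (take t (u @ rev (map Not v))) = disp (take (m - s) v)"
      using False u(1) uv by (simp add: s_def)
    then show ?thesis using v(3) by simp
  qed (use u in simp)
  then show ?thesis
    using u v uv ne by (simp add: tube_walks_def last_rev hd_map)
qed

text \<open>The first part is the maximal deviation bound. The second shows that returning to 0
  inside the tube has at least polynomially small probability, so dividing the first by the second
  keeps the exponential decay.\<close>

lemma tube_walks_bounds:
  assumes pq: "0 < p" "0 < q" "p + q = 1" and m: "1 \<le> m" "m \<le> n" and r: "3 \<le> r"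
    and n: "p / q \<le> sqrt (real n)"
    and small: "4 * real n * exp (1 + 3 * (p / q) - (of_int r - 3) / sqrt (real n)) \<le> 1 / 2"
  shows "(\<Sum>ts | ts \<in> tube_walks m r \<and> (\<exists>t \<le> 2 * m. r - 2 \<le> \<bar>disp (take t ts)\<bar>). walk_wt p q ts) \<le>
      4 * real n * exp (1 + 3 * (p / q) - (of_int r - 3) / sqrt (real n))" (is ?near)
    and "min p q / (36 * (real n)\<^sup>2) \<le> (\<Sum>ts \<in> tube_walks m r. walk_wt p q ts)" (is ?lower)
proof -
  \<comment> \<open>With walks of length at most \<open>2 * n\<close> the quadratic term
    \<open>p / q * \<eta>\<^sup>2 * L\<close> stays below \<open>2 * (p / q)\<close>, hence the 3 in
    \<open>E\<close>; the prefactor is twice the bound \<open>2 * n\<close> on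
    \<open>Suc L\<close>.\<close>
  define \<eta> where "\<eta> = 1 / sqrt (real n)"
  define E where "E = 4 * real n * exp (1 + 3 * (p / q) - (of_int r - 3) / sqrt (real n))"
  have n1: "1 \<le> n" using m by simp
  have \<eta>: "0 < \<eta>" "\<eta> \<le> 1" "p / q * \<eta> \<le> 1" "\<eta>\<^sup>2 = 1 / real n"
    using n1 divide_right_mono[OF n, of "sqrt (real n)"] by (auto simp: \<eta>_def power_divide)
  \<comment> \<open>The threshold is \<open>r - 3\<close> rather than \<open>r - 2\<close> because
    the first step is split off and may shift the displacement by 1.\<close>
  have dev: "(\<Sum>ts | length ts = L \<and> (\<exists>s \<le> L. r - 3 \<le> \<bar>disp (take s ts)\<bar>). walk_wt p q (x # ts)) \<le> E"
    if L: "Suc L \<le> 2 * n" for L x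
  proof -
    have "p / q * \<eta>\<^sup>2 * real L \<le> p / q * 2"
      using L n1 pq unfolding \<eta>(4) mult.assoc by (intro mult_left_mono) (auto simp: field_simps)
    then have "2 * real (Suc L) * exp (1 + p / q + p / q * \<eta>\<^sup>2 * real L - \<eta> * of_int (r - 3)) \<le> E"
      unfolding E_def using L by (rule_tac mult_mono) (auto simp: \<eta>_def)
    then show ?thesis using walk_wt_max_deviation[OF pq \<eta>(1-3), where L = L and R = "r - 3" and x = x] by linarith
  qed
  have pos: "walk_wt p q ts > 0" for ts using walk_wt_pos[OF pq] .
  show ?near
  proof -
    let ?A = "{ts. ts \<in> tube_walks m r \<and> (\<exists>t \<le> 2 * m. r - 2 \<le> \<bar>disp (take t ts)\<bar>)}"
    let ?B = "{ts. length ts = 2 * m - 1 \<and> (\<exists>s \<le> 2 * m - 1. r - 3 \<le> \<bar>disp (take s ts)\<bar>)}"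
    have finB: "finite ?B" by (rule finite_subset[OF _ finite_bool_lists[of "2 * m - 1"]]) auto
    have sub: "?A \<subseteq> Cons False ` ?B"
    proof
      fix ts assume ts: "ts \<in> ?A"
      then obtain u where u: "ts = False # u" using m by (cases ts) (auto simp: tube_walks_def)
      from ts obtain t where t: "t \<le> 2 * m" "r - 2 \<le> \<bar>disp (take t ts)\<bar>" by auto
      then have "t - 1 \<le> 2 * m - 1" "r - 3 \<le> \<bar>disp (take (t - 1) u)\<bar>"
        using disp_take_Cons[of t False u] u by auto
      then have "u \<in> ?B" using ts u by (auto simp: tube_walks_def)
      then show "ts \<in> Cons False ` ?B" using u by simp
    qed
    have "(\<Sum>ts \<in> ?A. walk_wt p q ts) \<le> (\<Sum>ts \<in> Cons False ` ?B. walk_wt p q ts)"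
      by (rule sum_mono2) (use sub finB pos in \<open>auto simp: less_imp_le\<close>)
    also have "\<dots> = (\<Sum>ts \<in> ?B. walk_wt p q (False # ts))" by (simp add: sum.reindex)
    also have "\<dots> \<le> E" by (rule dev) (use m in auto)
    finally show ?thesis unfolding E_def .
  qed
  show ?lower
  proof -
    define U where "U = {u. length u = m \<and> \<not> hd u \<and> (\<forall>t \<le> m. \<bar>disp (take t u)\<bar> \<le> r)}"
    have finU: "finite U" by (rule finite_subset[OF _ finite_bool_lists[of m]]) (auto simp: U_def)
    have half: "1 / 2 \<le> (\<Sum>u \<in> U. walk_wt p q u)"
    proof -
      let ?B = "{ts. length ts = m - 1 \<and> (\<exists>s \<le> m - 1. r - 3 \<le> \<bar>disp (take s ts)\<bar>)}"
      have sub: "bool_lists (m - 1) - ?B \<subseteq> {u. False # u \<in> U}"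
      proof
        fix u assume u: "u \<in> bool_lists (m - 1) - ?B"
        have "\<bar>disp (take t (False # u))\<bar> \<le> r" if "t \<le> m" for t
        proof -
          have "\<not> r - 3 \<le> \<bar>disp (take (t - 1) u)\<bar>" using u that by auto
          then show ?thesis using disp_take_Cons[of t False u] by linarith
        qed
        then show "u \<in> {u. False # u \<in> U}" using u m by (auto simp: U_def)
      qed
      have fin: "finite {u. False # u \<in> U}"
        by (rule finite_subset[OF _ finite_bool_lists[of "m - 1"]]) (auto simp: U_def)
      have "1 = (\<Sum>u \<in> bool_lists (m - 1). walk_wt p q (False # u))" using walk_wt_sum[OF pq] by simp
      also have "\<dots> = (\<Sum>u \<in> bool_lists (m - 1) - ?B. walk_wt p q (False # u)) + (\<Sum>u \<in> ?B. walk_wt p q (False # u))"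
        by (rule sum.subset_diff) auto
      also have "(\<Sum>u \<in> ?B. walk_wt p q (False # u)) \<le> E" by (rule dev) (use m in auto)
      also have "E \<le> 1 / 2" using small by (simp add: E_def)
      also have "(\<Sum>u \<in> bool_lists (m - 1) - ?B. walk_wt p q (False # u)) \<le> (\<Sum>u | False # u \<in> U. walk_wt p q (False # u))"
        by (rule sum_mono2) (use sub fin pos in \<open>auto simp: less_imp_le\<close>)
      also have "\<dots> = (\<Sum>u \<in> Cons False ` {u. False # u \<in> U}. walk_wt p q u)" by (simp add: sum.reindex)
      also have "\<dots> \<le> (\<Sum>u \<in> U. walk_wt p q u)"
        by (rule sum_mono2) (use finU pos in \<open>auto simp: less_imp_le\<close>)
      finally show ?thesis by simp
    qed
    define Uz where "Uz z = {u \<in> U. disp u = z}" for z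
    have "U = (\<Union>z \<in> {- int m..int m}. Uz z)"
    proof -
      have "disp u \<in> {- int m..int m}" if "u \<in> U" for u
        using that abs_disp_le[of u] by (auto simp: U_def)
      then show ?thesis by (auto simp: Uz_def)
    qed
    then have split: "(\<Sum>u \<in> U. walk_wt p q u) = (\<Sum>z \<in> {- int m..int m}. \<Sum>u \<in> Uz z. walk_wt p q u)"
      using finU by (simp only:) (subst sum.UNION_disjoint, auto simp: Uz_def)
    \<comment> \<open>Pigeonhole: half of the mass is spread over \<open>2 * m + 1\<close> end
      points, which are at most \<open>3 * n\<close>. Gluing two halves with this end point squares
      the bound, and the junction costs at most a factor \<open>min p q\<close>.\<close>
    have "\<exists>z. 1 / (6 * real n) \<le> (\<Sum>u \<in> Uz z. walk_wt p q u)"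
    proof (rule ccontr)
      assume "\<not> ?thesis"
      then have "(\<Sum>z \<in> {- int m..int m}. \<Sum>u \<in> Uz z. walk_wt p q u) < (\<Sum>z \<in> {- int m..int m}. 1 / (6 * real n))"
        by (intro sum_strict_mono) (auto simp: not_le)
      also have "\<dots> = (2 * real m + 1) / (6 * real n)" by simp
      also have "\<dots> \<le> 1 / 2" using m by (simp add: field_simps)
      finally show False using half split by linarith
    qed
    then obtain z where z: "1 / (6 * real n) \<le> (\<Sum>u \<in> Uz z. walk_wt p q u)" by blast
    define glue where "glue = (\<lambda>(u, v). u @ rev (map Not v))"
    have inj: "inj_on glue (Uz z \<times> Uz z)"
      by (auto simp: inj_on_def glue_def Uz_def U_def inj_map_eq_map[OF inj_on_subset[OF _ subset_UNIV]] inj_def)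
    have sub: "glue ` (Uz z \<times> Uz z) \<subseteq> tube_walks m r"
      using m by (auto simp: glue_def Uz_def U_def intro!: tube_walks_glue)
    have "min p q / (36 * (real n)\<^sup>2) = min p q * (1 / (6 * real n))\<^sup>2"
      by (simp add: power_divide power_mult_distrib)
    also have "\<dots> \<le> min p q * (\<Sum>u \<in> Uz z. walk_wt p q u)\<^sup>2"
      using z pq by (intro mult_left_mono power_mono) auto
    also have "\<dots> = (\<Sum>(u, v) \<in> Uz z \<times> Uz z. min p q * (walk_wt p q u * walk_wt p q v))"
      unfolding power2_eq_square sum_product sum.cartesian_product[symmetric]
      by (simp only: sum_distrib_left)
    also have "\<dots> \<le> (\<Sum>uv \<in> Uz z \<times> Uz z. walk_wt p q (glue uv))"
    proof (rule sum_mono)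
      fix uv assume uv: "uv \<in> Uz z \<times> Uz z"
      obtain u v where [simp]: "uv = (u, v)" by (cases uv)
      have "u \<noteq> []" "v \<noteq> []" using uv m by (auto simp: Uz_def U_def)
      then have "walk_wt p q (glue uv) = walk_wt p q u * (if last u = hd (rev (map Not v)) then p else q) * walk_wt p q v"
        unfolding glue_def by (simp add: walk_wt_append walk_wt_rev walk_wt_map_Not)
      moreover have "min p q * (walk_wt p q u * walk_wt p q v) \<le>
          (if last u = hd (rev (map Not v)) then p else q) * (walk_wt p q u * walk_wt p q v)"
        using pos[of u] pos[of v] by (intro mult_right_mono) auto
      ultimately show "(case uv of (u, v) \<Rightarrow> min p q * (walk_wt p q u * walk_wt p q v)) \<le> walk_wt p q (glue uv)"
        by (simp add: algebra_simps)
    qed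
    also have "\<dots> = (\<Sum>ts \<in> glue ` (Uz z \<times> Uz z). walk_wt p q ts)" by (simp add: sum.reindex[OF inj])
    also have "\<dots> \<le> (\<Sum>ts \<in> tube_walks m r. walk_wt p q ts)"
      by (rule sum_mono2) (use sub pos in \<open>auto simp: less_imp_le\<close>)
    finally show ?thesis .
  qed
qed

section \<open>Lattice paths\<close>

text \<open>\<open>tilt\<close> is the coordinate across the paths, constant on diagonals;
  \<open>level\<close> is the coordinate along them and drops by one with every step.\<close>

definition tilt :: "edge \<Rightarrow> int" where
  "tilt e = int (snd (lower_end e)) - int (fst (lower_end e))"

definition level :: "edge \<Rightarrow> nat" where
  "level e = fst (lower_end e) + snd (lower_end e)"

lemma tilt_simps [simp]: "tilt (Hor i j) = int j - int i" "tilt (Ver i j) = int j - int i"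
  by (simp_all add: tilt_def)

lemma level_simps [simp]: "level (Hor i j) = i + j" "level (Ver i j) = i + j"
  by (simp_all add: level_def)

text \<open>
  The path of a walk starts at the point \<open>(m, n + 1)\<close> and goes left at \<open>True\<close> and down at \<open>False\<close>.
\<close>

definition walk_pos :: "nat \<Rightarrow> nat \<Rightarrow> bool list \<Rightarrow> nat \<Rightarrow> vertex" where
  "walk_pos m n ts t = (m - length (filter (\<lambda>x. x) (take t ts)), n + 1 - length (filter Not (take t ts)))"

text \<open>Edges are named by their lower end, which for a step left or down is the position after
  the step; hence \<open>Suc t\<close>.\<close>

definition walk_edge :: "nat \<Rightarrow> nat \<Rightarrow> bool list \<Rightarrow> nat \<Rightarrow> edge" where
  "walk_edge m n ts t = (case walk_pos m n ts (Suc t) of (i, j) \<Rightarrow> if ts ! t then Hor i j else Ver i j)"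

definition walk_path :: "nat \<Rightarrow> nat \<Rightarrow> bool list \<Rightarrow> edge set" where
  "walk_path m n ts = walk_edge m n ts ` {..<length ts}"

definition bridges :: "nat \<Rightarrow> bool list set" where
  "bridges m = {ts. length ts = 2 * m \<and> \<not> hd ts \<and> last ts \<and> disp ts = 0}"

lemma length_filter_add: "length (filter (\<lambda>x. x) ts) + length (filter Not ts) = length ts"
  by (induction ts) auto

lemma length_filter_diff: "int (length (filter (\<lambda>x. x) ts)) - int (length (filter Not ts)) = disp ts"
  by (induction ts) auto

lemma lower_end_walk_edge [simp]: "lower_end (walk_edge m n ts t) = walk_pos m n ts (Suc t)"
  by (auto simp: walk_edge_def split: prod.split)

lemma walk_pos_Suc:
  "t < length ts \<Longrightarrow> walk_pos m n ts (Suc t) = (case walk_pos m n ts t of (i, j) \<Rightarrow>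
    if ts ! t then (i - 1, j) else (i, j - 1))"
  by (simp add: walk_pos_def take_Suc_conv_app_nth)

text \<open>The strict bounds come from the fixed last and first steps. They make the truncated
  subtractions in \<open>walk_pos\<close> exact and keep all positions at intermediate times inside
  the grid.\<close>

lemma bridge_counts:
  assumes ts: "ts \<in> bridges m" and m: "1 \<le> m" and t: "t \<le> 2 * m"
  shows "length (filter (\<lambda>x. x) (take t ts)) \<le> m" "length (filter Not (take t ts)) \<le> m"
    "t < 2 * m \<Longrightarrow> length (filter (\<lambda>x. x) (take t ts)) < m"
    "0 < t \<Longrightarrow> 0 < length (filter Not (take t ts))"
    "length (filter (\<lambda>x. x) (take t ts)) + length (filter Not (take t ts)) = t"
proof -
  have len: "length ts = 2 * m" using ts by (simp add: bridges_def)
  have ne: "ts \<noteq> []" using len m by auto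
  have tot: "length (filter (\<lambda>x. x) ts) = m" "length (filter Not ts) = m"
    using length_filter_add[of ts] length_filter_diff[of ts] ts by (auto simp: bridges_def)
  have split: "length (filter P (take t ts)) + length (filter P (drop t ts)) = length (filter P ts)" for P
    by (metis append_take_drop_id filter_append length_append)
  show "length (filter (\<lambda>x. x) (take t ts)) \<le> m" "length (filter Not (take t ts)) \<le> m"
    using split[of "\<lambda>x. x"] split[of Not] tot by auto
  show "length (filter (\<lambda>x. x) (take t ts)) < m" if "t < 2 * m"
  proof -
    have "drop t ts \<noteq> []" using that len by simp
    then have "last ts \<in> set (drop t ts)" by (metis last_drop last_in_set drop_eq_Nil not_le)
    then have "length (filter (\<lambda>x. x) (drop t ts)) > 0" using ts by (auto simp: bridges_def filter_empty_conv)
    then show ?thesis using split[of "\<lambda>x. x"] tot by linarith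
  qed
  show "0 < length (filter Not (take t ts))" if "0 < t"
  proof -
    have "hd ts \<in> set (take t ts)" using that ne by (cases ts; cases t) auto
    then show ?thesis using ts by (auto simp: bridges_def filter_empty_conv)
  qed
  show "length (filter (\<lambda>x. x) (take t ts)) + length (filter Not (take t ts)) = t"
    using length_filter_add[of "take t ts"] t len by simp
qed

context
  fixes m n :: nat and ts :: "bool list"
  assumes ts: "ts \<in> bridges m" and m: "1 \<le> m" "m \<le> n"
begin

lemma length_bridge: "length ts = 2 * m"
  using ts by (simp add: bridges_def)

lemma walk_pos_coords:
  assumes "t \<le> 2 * m"
  shows "fst (walk_pos m n ts t) + snd (walk_pos m n ts t) + t = m + n + 1"
    "int (snd (walk_pos m n ts t)) - int (fst (walk_pos m n ts t)) = int (n + 1) - int m + disp (take t ts)"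
  using bridge_counts[OF ts m(1) assms] m length_filter_diff[of "take t ts"]
  by (auto simp: walk_pos_def of_nat_diff)

lemma walk_pos_vertices:
  assumes "0 < t" "t < 2 * m"
  shows "walk_pos m n ts t \<in> vertices n"
proof -
  have "length (filter Not (take t ts)) \<ge> 1" "length (filter Not (take t ts)) \<le> n"
    "length (filter (\<lambda>x. x) (take t ts)) < m"
    using bridge_counts[OF ts m(1), of t] assms m by linarith+
  then show ?thesis using m unfolding walk_pos_def vertices_def by auto
qed

lemma level_walk_edge: "t < 2 * m \<Longrightarrow> level (walk_edge m n ts t) + t = m + n"
  using walk_pos_coords(1)[of "Suc t"] by (simp add: level_def)

lemma tilt_walk_edge:
  "t < 2 * m \<Longrightarrow> tilt (walk_edge m n ts t) = int (n + 1) - int m + disp (take (Suc t) ts)"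
  using walk_pos_coords(2)[of "Suc t"] by (simp add: tilt_def)

lemma upper_end_walk_edge:
  assumes t: "t < 2 * m"
  shows "upper_end (walk_edge m n ts t) = walk_pos m n ts t"
proof -
  have "fst (walk_pos m n ts t) \<ge> 1"
    using bridge_counts(3)[OF ts m(1), of t] t by (simp add: walk_pos_def)
  moreover have "\<not> ts ! t \<Longrightarrow> snd (walk_pos m n ts t) \<ge> 1"
    using bridge_counts(2)[OF ts m(1), of t] t m by (simp add: walk_pos_def)
  ultimately show ?thesis
    using walk_pos_Suc[of t ts m n] t length_bridge
    by (auto simp: walk_edge_def split: prod.splits)
qed

lemma walk_path_edges: "walk_path m n ts \<subseteq> edges n"
proof
  fix e assume "e \<in> walk_path m n ts"
  then obtain t where t: "t < 2 * m" "e = walk_edge m n ts t"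
    by (auto simp: walk_path_def length_bridge)
  show "e \<in> edges n"
  proof (cases "t = 0")
    case True
    then have "lower_end e \<in> vertices n" using walk_pos_vertices[of 1] t m by simp
    then show ?thesis by (simp add: edges_def)
  next
    case False
    then have "upper_end e \<in> vertices n" using walk_pos_vertices[of t] t upper_end_walk_edge by simp
    then show ?thesis by (simp add: edges_def)
  qed
qed

lemma walk_pos_inj: "s \<le> 2 * m \<Longrightarrow> t \<le> 2 * m \<Longrightarrow> walk_pos m n ts s = walk_pos m n ts t \<Longrightarrow> s = t"
  using walk_pos_coords(1)[of s] walk_pos_coords(1)[of t] by simp

text \<open>A path meets each point at most once, arriving from the right or from above by step
  \<open>t - 1\<close> and departing by step \<open>t\<close>. So it uses exactly one edge of each
  pair.\<close>

lemma walk_path_at_visited: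
  assumes t: "0 < t" "t < 2 * m" and ij: "walk_pos m n ts t = (i, j)"
  shows "Hor i j \<in> walk_path m n ts \<longleftrightarrow> ts ! (t - 1)" "Ver i j \<in> walk_path m n ts \<longleftrightarrow> \<not> ts ! (t - 1)"
    "Hor (i - 1) j \<in> walk_path m n ts \<longleftrightarrow> ts ! t" "Ver i (j - 1) \<in> walk_path m n ts \<longleftrightarrow> \<not> ts ! t"
proof -
  have pos: "1 \<le> i" "1 \<le> j" using walk_pos_vertices[OF t] ij by (auto simp: vertices_def)
  have lower: "e \<in> walk_path m n ts \<longleftrightarrow> e = walk_edge m n ts (t - 1)" if e: "lower_end e = (i, j)" for e
  proof
    assume "e \<in> walk_path m n ts"
    then obtain s where s: "s < 2 * m" "e = walk_edge m n ts s"
      by (auto simp: walk_path_def length_bridge)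
    then have "Suc s = t" using walk_pos_inj[of "Suc s" t] e ij t by simp
    then show "e = walk_edge m n ts (t - 1)" using s by auto
  qed (use t in \<open>auto simp: walk_path_def length_bridge\<close>)
  have upper: "e \<in> walk_path m n ts \<longleftrightarrow> e = walk_edge m n ts t" if e: "upper_end e = (i, j)" for e
  proof
    assume "e \<in> walk_path m n ts"
    then obtain s where s: "s < 2 * m" "e = walk_edge m n ts s"
      by (auto simp: walk_path_def length_bridge)
    then have "s = t" using walk_pos_inj[of s t] upper_end_walk_edge e ij t by simp
    then show "e = walk_edge m n ts t" using s by auto
  qed (use t in \<open>auto simp: walk_path_def length_bridge\<close>)
  have "walk_edge m n ts (t - 1) = (if ts ! (t - 1) then Hor i j else Ver i j)"
    using t ij by (simp add: walk_edge_def)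
  then show "Hor i j \<in> walk_path m n ts \<longleftrightarrow> ts ! (t - 1)" "Ver i j \<in> walk_path m n ts \<longleftrightarrow> \<not> ts ! (t - 1)"
    using lower[of "Hor i j"] lower[of "Ver i j"] by auto
  have "walk_edge m n ts t = (if ts ! t then Hor (i - 1) j else Ver i (j - 1))"
    using walk_pos_Suc[of t ts m n] t ij by (simp add: walk_edge_def length_bridge)
  then show "Hor (i - 1) j \<in> walk_path m n ts \<longleftrightarrow> ts ! t" "Ver i (j - 1) \<in> walk_path m n ts \<longleftrightarrow> \<not> ts ! t"
    using upper[of "Hor (i - 1) j"] upper[of "Ver i (j - 1)"] pos by auto
qed

lemma walk_path_at_unvisited:
  assumes e: "e \<in> walk_path m n ts" and v: "lower_end e = v \<or> upper_end e = v" "v \<in> vertices n"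
  shows "v \<in> walk_pos m n ts ` {0<..<2 * m}"
proof -
  obtain s where s: "s < 2 * m" "e = walk_edge m n ts s"
    using e by (auto simp: walk_path_def length_bridge)
  have "walk_pos m n ts 0 \<notin> vertices n" by (simp add: walk_pos_def vertices_def)
  moreover have "walk_pos m n ts (2 * m) \<notin> vertices n"
  proof -
    have "length (filter (\<lambda>x. x) ts) = m"
      using length_filter_add[of ts] length_filter_diff[of ts] ts by (auto simp: bridges_def)
    then show ?thesis by (simp add: walk_pos_def vertices_def length_bridge)
  qed
  ultimately have "v = walk_pos m n ts s \<and> s \<noteq> 0 \<or> v = walk_pos m n ts (Suc s) \<and> Suc s \<noteq> 2 * m"
    using v s upper_end_walk_edge[OF s(1)] by (metis lower_end_walk_edge)
  then show ?thesis using s by auto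
qed

lemma walk_path_dangling:
  "walk_path m n ts \<inter> dangling_edges n = {Ver m n, Hor 0 (n - m + 1)}"
proof -
  have tot: "length (filter (\<lambda>x. x) ts) = m" "length (filter Not ts) = m"
    using length_filter_add[of ts] length_filter_diff[of ts] ts by (auto simp: bridges_def)
  have ne: "ts \<noteq> []" using length_bridge m by auto
  have first: "walk_edge m n ts 0 = Ver m n"
    using ts ne by (cases ts) (auto simp: walk_edge_def walk_pos_def bridges_def)
  have "ts ! (2 * m - 1)" using ts ne length_bridge by (auto simp: bridges_def last_conv_nth)
  moreover have "walk_pos m n ts (2 * m) = (0, n - m + 1)"
    using tot m by (simp add: walk_pos_def length_bridge)
  ultimately have final: "walk_edge m n ts (2 * m - 1) = Hor 0 (n - m + 1)"
    using m by (simp add: walk_edge_def)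
  have "e \<in> {Ver m n, Hor 0 (n - m + 1)}" if e: "e \<in> walk_path m n ts" "e \<in> dangling_edges n" for e
  proof -
    obtain s where s: "s < 2 * m" "e = walk_edge m n ts s"
      using e by (auto simp: walk_path_def length_bridge)
    have "s = 0 \<or> s = 2 * m - 1"
    proof (rule ccontr)
      assume "\<not> ?thesis"
      then have "lower_end e \<in> vertices n" "upper_end e \<in> vertices n"
        using walk_pos_vertices[of s] walk_pos_vertices[of "Suc s"] s upper_end_walk_edge by auto
      then show False using e by (simp add: dangling_edges_def)
    qed
    then show ?thesis using first final s by auto
  qed
  moreover have "Ver m n \<in> walk_path m n ts" "Hor 0 (n - m + 1) \<in> walk_path m n ts"
    using first final m by (auto simp: walk_path_def length_bridge intro: image_eqI[of _ _ 0] image_eqI[of _ _ "2 * m - 1"])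
  ultimately show ?thesis using m by auto
qed

end

text \<open>The level of an edge determines the time at which it is traversed, and its kind the step
  taken then.\<close>

lemma walk_path_inj:
  assumes "ts \<in> bridges m" "us \<in> bridges m" "1 \<le> m" "m \<le> n"
    and eq: "walk_path m n ts = walk_path m n us"
  shows "ts = us"
proof (rule nth_equalityI)
  show "length ts = length us" using assms by (simp add: bridges_def)
  fix t assume t: "t < length ts"
  then have "walk_edge m n ts t \<in> walk_path m n us" using eq by (auto simp: walk_path_def)
  then obtain s where s: "s < 2 * m" "walk_edge m n ts t = walk_edge m n us s"
    using assms by (auto simp: walk_path_def bridges_def)
  have "t < 2 * m" using t assms by (simp add: bridges_def)
  then have "s = t"
    using s level_walk_edge[OF assms(1,3,4)] level_walk_edge[OF assms(2,3,4)] by (metis add_left_cancel)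
  then show "ts ! t = us ! t" using s by (auto simp: walk_edge_def split: prod.splits if_splits)
qed

text \<open>
  A balanced set of edges with a single source is a path: every edge but the source has a predecessor
  one level up, so each level contains at most one edge.
\<close>

lemma balanced_set_is_path:
  assumes m: "1 \<le> m" "m \<le> n" and sub: "P \<subseteq> edges n"
    and bal: "\<And>i j. (i, j) \<in> vertices n \<Longrightarrow>
      of_bool (Hor i j \<in> P) + of_bool (Ver i j \<in> P) =
      (of_bool (Hor (i - 1) j \<in> P) + of_bool (Ver i (j - 1) \<in> P) :: nat)"
    and dang: "P \<inter> dangling_edges n = {Ver m n, Hor 0 (n - m + 1)}"
  shows "\<exists>ts \<in> bridges m. P = walk_path m n ts"
proof -
  have start: "Ver m n \<in> P" and stop: "Hor 0 (n - m + 1) \<in> P" using dang by auto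
  \<comment> \<open>Balance at the upper end supplies an edge of \<open>P\<close> one level higher.
    The upper end is a vertex because \<open>Ver m n\<close> is the only edge of \<open>P\<close>
    coming in from outside.\<close>
  have pred: "upper_end e \<in> vertices n \<and> (\<exists>e' \<in> P. lower_end e' = upper_end e)"
    if e: "e \<in> P" "e \<noteq> Ver m n" for e
  proof -
    have V: "upper_end e \<in> vertices n"
    proof (rule ccontr)
      assume "upper_end e \<notin> vertices n"
      then have "e \<in> dangling_edges n" "e \<noteq> Hor 0 (n - m + 1)"
        using sub e m by (auto simp: dangling_edges_def vertices_def)
      then show False using dang e by auto
    qed
    obtain i j where ij: "upper_end e = (i, j)" by (cases "upper_end e")
    then have "e = Hor (i - 1) j \<or> e = Ver i (j - 1)" by (cases e) auto
    then have "of_bool (Hor (i - 1) j \<in> P) + of_bool (Ver i (j - 1) \<in> P) \<ge> (1 :: nat)" using e(1) by auto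
    then have "of_bool (Hor i j \<in> P) + of_bool (Ver i j \<in> P) \<ge> (1 :: nat)" using bal[of i j] V ij by simp
    then have "Hor i j \<in> P \<or> Ver i j \<in> P" by (cases "Hor i j \<in> P"; cases "Ver i j \<in> P") auto
    then show ?thesis using V ij by (metis lower_end.simps)
  qed
  have level_up: "level e' = Suc (level e)" if "lower_end e' = upper_end e" for e e'
    using that by (cases e) (auto simp: level_def)
  \<comment> \<open>Climbing through predecessors raises the level, which is bounded, so the climb
    must stop, and it can stop only at \<open>Ver m n\<close>.\<close>
  have level_le: "level e \<le> m + n" if "e \<in> P" for e
    using that
  proof (induction "2 * n - level e" arbitrary: e rule: less_induct)
    case less
    show ?case
    proof (cases "e = Ver m n")
      case False
      then obtain e' where e': "e' \<in> P" "lower_end e' = upper_end e" using pred less by blast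
      have "level e' \<le> 2 * n" using e'(1) sub by (cases e') auto
      then have "level e' \<le> m + n" using less(1)[of e'] e' level_up[OF e'(2)] by simp
      then show ?thesis using level_up[OF e'(2)] by simp
    qed simp
  qed
  have single: "t < 2 * m \<Longrightarrow> \<exists>!e. e \<in> P \<and> level e + t = m + n" for t
  proof (induction t)
    case 0
    have "e = Ver m n" if e: "e \<in> P \<and> level e + 0 = m + n" for e
    proof (rule ccontr)
      assume "e \<noteq> Ver m n"
      then obtain e' where "e' \<in> P" "lower_end e' = upper_end e" using pred e by blast
      then show False using level_up[of e' e] level_le[of e'] e by simp
    qed
    moreover have "Ver m n \<in> P \<and> level (Ver m n) + 0 = m + n" using start by simp
    ultimately show ?case by blast
  next
    case (Suc t)
    then obtain e where e: "e \<in> P" "level e + t = m + n"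
      and uniq: "\<And>e'. e' \<in> P \<Longrightarrow> level e' + t = m + n \<Longrightarrow> e' = e" by auto
    obtain i j where ij: "lower_end e = (i, j)" by (cases "lower_end e")
    have lev: "i + j + t = m + n" using e ij by (simp add: level_def)
    have V: "(i, j) \<in> vertices n"
    proof (rule ccontr)
      assume "(i, j) \<notin> vertices n"
      then have "e \<in> dangling_edges n" "e \<noteq> Ver m n"
        using sub e m ij by (auto simp: dangling_edges_def vertices_def)
      then have "e = Hor 0 (n - m + 1)" using dang e by auto
      then show False using e Suc.prems m by simp
    qed
    have "of_bool (Hor i j \<in> P) + of_bool (Ver i j \<in> P) = (1 :: nat)"
    proof (cases e)
      case (Hor i' j')
      then have "Ver i j \<notin> P" using uniq[of "Ver i j"] lev by auto
      then show ?thesis using Hor ij e by simp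
    next
      case (Ver i' j')
      then have "Hor i j \<notin> P" using uniq[of "Hor i j"] lev by auto
      then show ?thesis using Ver ij e by simp
    qed
    then have one: "of_bool (Hor (i - 1) j \<in> P) + of_bool (Ver i (j - 1) \<in> P) = (1 :: nat)"
      using bal[OF V] by simp
    have next_edge: "e' = Hor (i - 1) j \<or> e' = Ver i (j - 1)" if e': "e' \<in> P" "level e' + Suc t = m + n" for e'
    proof -
      have "e' \<noteq> Ver m n" using e' by auto
      then obtain e'' where e'': "e'' \<in> P" "lower_end e'' = upper_end e'" using pred e' by blast
      then have "e'' = e" using uniq[of e''] level_up[of e'' e'] e' by simp
      then have "upper_end e' = (i, j)" using e'' ij by simp
      then show ?thesis by (cases e') auto
    qed
    have "1 \<le> i" "1 \<le> j" using V by (auto simp: vertices_def)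
    then have lev': "level (Hor (i - 1) j) + Suc t = m + n" "level (Ver i (j - 1)) + Suc t = m + n"
      using lev by auto
    from one consider "Hor (i - 1) j \<in> P" "Ver i (j - 1) \<notin> P" | "Hor (i - 1) j \<notin> P" "Ver i (j - 1) \<in> P"
      by (cases "Hor (i - 1) j \<in> P"; cases "Ver i (j - 1) \<in> P") auto
    then show ?case
      by cases (use next_edge lev' in blast)+
  qed
  define E where "E t = (THE e. e \<in> P \<and> level e + t = m + n)" for t
  have E: "E t \<in> P" "level (E t) + t = m + n" if "t < 2 * m" for t
    using theI'[OF single[OF that]] by (auto simp: E_def)
  have E_uniq: "e = E t" if "t < 2 * m" "e \<in> P" "level e + t = m + n" for e t
    using single[OF that(1)] E[OF that(1)] that by blast
  define ts where "ts = map (\<lambda>t. \<exists>i j. E t = Hor i j) [0..<2 * m]"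
  have len: "length ts = 2 * m" by (simp add: ts_def)
  have ts_nth: "ts ! t \<longleftrightarrow> (\<exists>i j. E t = Hor i j)" if "t < 2 * m" for t
    using that by (simp add: ts_def)
  have E0: "E 0 = Ver m n" using E_uniq[of 0 "Ver m n"] m start by simp
  have Elast: "E (2 * m - 1) = Hor 0 (n - m + 1)"
    using E_uniq[of "2 * m - 1" "Hor 0 (n - m + 1)"] m stop by simp
  have E_pos: "t < 2 * m \<Longrightarrow> lower_end (E t) = walk_pos m n ts (Suc t)" for t
  proof (induction t)
    case 0
    then show ?case using walk_pos_Suc[of 0 ts m n] ts_nth[of 0] E0 len m
      by (simp add: walk_pos_def)
  next
    case (Suc t)
    have "E (Suc t) \<noteq> Ver m n" using E(2)[OF Suc.prems] by auto
    then obtain e' where e': "e' \<in> P" "lower_end e' = upper_end (E (Suc t))"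
      using pred E(1)[OF Suc.prems] by blast
    then have "e' = E t" using E_uniq[of t e'] level_up[OF e'(2)] E(2)[OF Suc.prems] Suc.prems by simp
    then have "upper_end (E (Suc t)) = walk_pos m n ts (Suc t)" using e' Suc by simp
    then show ?case
      using walk_pos_Suc[of "Suc t" ts m n] Suc.prems len ts_nth[OF Suc.prems]
      by (cases "E (Suc t)") (auto split: prod.splits)
  qed
  have E_edge: "walk_edge m n ts t = E t" if "t < 2 * m" for t
    using E_pos[OF that] ts_nth[OF that]
    by (cases "E t") (auto simp: walk_edge_def split: prod.splits)
  \<comment> \<open>An edge below the exit level would lead upwards to
    \<open>Hor 0 (n - m + 1)\<close> as a predecessor, whose lower end is not a vertex.\<close>
  have no_more: "\<not> (e \<in> P \<and> level e + t = m + n)" if "2 * m \<le> t" for t e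
    using that
  proof (induction t arbitrary: e rule: nat_induct_at_least)
    case base
    show ?case
    proof
      assume e: "e \<in> P \<and> level e + 2 * m = m + n"
      then have "level e \<noteq> level (Ver m n)" using m by simp
      then have "e \<noteq> Ver m n" by blast
      then obtain e' where e': "e' \<in> P" "lower_end e' = upper_end e" "upper_end e \<in> vertices n"
        using pred e by blast
      then have "e' = E (2 * m - 1)" using E_uniq[of "2 * m - 1" e'] level_up[OF e'(2)] e m by simp
      then show False using e' Elast by (auto simp: vertices_def)
    qed
  next
    case (Suc t)
    show ?case
    proof
      assume e: "e \<in> P \<and> level e + Suc t = m + n"
      then have "level e \<noteq> level (Ver m n)" by simp
      then have "e \<noteq> Ver m n" by blast
      then obtain e' where e': "e' \<in> P" "lower_end e' = upper_end e" using pred e by blast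
      then show False using Suc.IH[of e'] level_up[OF e'(2)] e by simp
    qed
  qed
  have "P = walk_path m n ts"
  proof
    show "P \<subseteq> walk_path m n ts"
    proof
      fix e assume e: "e \<in> P"
      define t where "t = m + n - level e"
      have t: "level e + t = m + n" using level_le[OF e] by (simp add: t_def)
      then have "t < 2 * m" using no_more[of t e] e by force
      then show "e \<in> walk_path m n ts" using E_uniq[of t e] E_edge t e len by (auto simp: walk_path_def)
    qed
    show "walk_path m n ts \<subseteq> P" using E E_edge len by (auto simp: walk_path_def)
  qed
  moreover have "ts \<in> bridges m"
  proof -
    have ne: "ts \<noteq> []" using len m by auto
    have "walk_pos m n ts (2 * m) = (0, n - m + 1)"
      using E_pos[of "2 * m - 1"] Elast m by simp
    then have "length (filter (\<lambda>x. x) ts) \<ge> m" "length (filter Not ts) = m"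
      using m len by (auto simp: walk_pos_def)
    then have "disp ts = 0" using length_filter_add[of ts] length_filter_diff[of ts] len by simp
    moreover have "\<not> hd ts" using ts_nth[of 0] E0 ne m by (simp add: hd_conv_nth)
    moreover have "last ts" using ts_nth[of "2 * m - 1"] Elast ne m len by (simp add: last_conv_nth)
    ultimately show ?thesis using len by (simp add: bridges_def)
  qed
  ultimately show ?thesis by blast
qed

section \<open>States confined to tubes\<close>

text \<open>\<open>False\<close> marks an edge used by a path. Path \<open>k\<close> starts above
  column \<open>n - k * D\<close> and leaves in row \<open>k * D + 1\<close>; both its end points
  \<open>(n - k * D, n + 1)\<close> and \<open>(0, k * D + 1)\<close> lie on the diagonal of tilt
  \<open>k * D + 1\<close>, the centre of its tube.\<close>

definition lines_boundary :: "nat \<Rightarrow> nat \<Rightarrow> nat \<Rightarrow> orientation" where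
  "lines_boundary n K D = (\<lambda>e. e \<notin> (\<Union>k \<in> {1..K}. {Ver (n - k * D) n, Hor 0 (k * D + 1)}))"

definition tube :: "nat \<Rightarrow> nat \<Rightarrow> nat \<Rightarrow> edge set" where
  "tube D r k = {e. \<bar>tilt e - int (k * D + 1)\<bar> \<le> int r}"

definition tube_states :: "nat \<Rightarrow> nat \<Rightarrow> nat \<Rightarrow> nat \<Rightarrow> orientation set" where
  "tube_states n K D r = {x \<in> states n (lines_boundary n K D).
     \<forall>e \<in> edges n. \<not> x e \<longrightarrow> (\<exists>k \<in> {1..K}. e \<in> tube D r k)}"

definition lines_state :: "nat \<Rightarrow> nat \<Rightarrow> nat \<Rightarrow> (nat \<Rightarrow> bool list) \<Rightarrow> orientation" where
  "lines_state n K D \<omega> =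
     (\<lambda>e. if e \<in> edges n then e \<notin> (\<Union>k \<in> {1..K}. walk_path (n - k * D) n (\<omega> k)) else undefined)"

definition vertex_weight :: "real \<Rightarrow> real \<Rightarrow> real \<Rightarrow> orientation \<Rightarrow> vertex \<Rightarrow> real" where
  "vertex_weight a b c x v =
     (if type_a x v then a else 1) * (if type_b x v then b else 1) * (if type_c x v then c else 1)"

lemma weight_eq_prod: "weight a b c n x = (\<Prod>v \<in> vertices n. vertex_weight a b c x v)"
  by (simp add: weight_def vertex_weight_def prod.distrib prod.If_cases Collect_conj_eq Int_commute)

lemma vertex_weight_type:
  "type_a x v \<Longrightarrow> vertex_weight a b c x v = a"
  "type_b x v \<Longrightarrow> vertex_weight a b c x v = b"
  "type_c x v \<Longrightarrow> vertex_weight a b c x v = c"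
  by (cases v; auto simp: vertex_weight_def)+

text \<open>Splits the relative weights b / a = l p and c / a = l q into a loss \<open>l\<close> per
  visited vertex and transition probabilities \<open>p\<close> and \<open>q\<close>.\<close>

lemma prod_nth_walk_wt:
  "(\<Prod>t < length ts - 1. if ts ! t = ts ! Suc t then l * p else l * q) =
    l ^ (length ts - 1) * walk_wt p q ts"
proof (induction p q ts rule: walk_wt.induct)
  case (1 p q x y ts)
  have "(\<Prod>t < length (x # y # ts) - 1. if (x # y # ts) ! t = (x # y # ts) ! Suc t then l * p else l * q) =
      (if x = y then l * p else l * q) *
      (\<Prod>t < length (y # ts) - 1. if (y # ts) ! t = (y # ts) ! Suc t then l * p else l * q)"
    by (simp add: prod.lessThan_Suc_shift del: prod.lessThan_Suc)
  then show ?case unfolding 1 by simp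
qed auto

lemma PiE_filter:
  "k \<in> I \<Longrightarrow> {\<omega> \<in> Pi\<^sub>E I A. P (\<omega> k)} = Pi\<^sub>E I (\<lambda>j. if j = k then {t \<in> A k. P t} else A j)"
  by (auto simp: PiE_def Pi_def extensional_def split: if_splits)

lemma tube_walks_subset_bridges: "tube_walks m r \<subseteq> bridges m"
  by (auto simp: tube_walks_def bridges_def)

lemma tube_walks_iff:
  "ts \<in> tube_walks m r \<longleftrightarrow> ts \<in> bridges m \<and> (\<forall>t \<le> 2 * m. \<bar>disp (take t ts)\<bar> \<le> r)"
  by (auto simp: tube_walks_def bridges_def)

section \<open>Confined states as independent families of walks\<close>

context
  fixes n K D r :: nat
  assumes r: "1 \<le> r" and D: "2 * r + 3 \<le> D" and KD: "K * D < n"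
begin

abbreviation "len k \<equiv> n - k * D"

abbreviation "walk_families \<equiv> Pi\<^sub>E {1..K} (\<lambda>k. tube_walks (len k) (int r))"

text \<open>The centres are at least \<open>2 * r + 3\<close> apart, so edges of different tubes
  differ in tilt by at least 3, whereas the four edges at a vertex differ by at most 2. A vertex
  thus meets at most one tube.\<close>

lemma tube_separation:
  assumes "e \<in> tube D r k" "e' \<in> tube D r l" "\<bar>tilt e - tilt e'\<bar> \<le> 2"
  shows "k = l"
proof (rule ccontr)
  assume "k \<noteq> l"
  then consider "Suc k \<le> l" | "Suc l \<le> k" by linarith
  then have "k * D + D \<le> l * D \<or> l * D + D \<le> k * D"
    by cases (metis add.commute mult_Suc mult_le_mono1)+
  then have "int (k * D) + int D \<le> int (l * D) \<or> int (l * D) + int D \<le> int (k * D)"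
    by (metis of_nat_add of_nat_le_iff)
  then show False using assms D by (auto simp: tube_def)
qed

lemma len_bounds:
  assumes "k \<in> {1..K}"
  shows "1 \<le> len k" "len k \<le> n" "int (n + 1) - int (len k) = int (k * D + 1)" "n - len k + 1 = k * D + 1"
proof -
  define d where "d = k * D"
  have "k * D \<le> K * D" using assms by simp
  then have "d < n" using KD by (simp only: d_def)
  then show "1 \<le> len k" "len k \<le> n" "int (n + 1) - int (len k) = int (k * D + 1)" "n - len k + 1 = k * D + 1"
    unfolding d_def[symmetric] by auto
qed

lemma walk_path_in_tube_iff:
  assumes k: "k \<in> {1..K}" and ts: "ts \<in> bridges (len k)"
  shows "walk_path (len k) n ts \<subseteq> tube D r k \<longleftrightarrow> ts \<in> tube_walks (len k) (int r)"
proof -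
  note b = len_bounds[OF k]
  have "walk_path (len k) n ts \<subseteq> tube D r k \<longleftrightarrow> (\<forall>t < 2 * len k. \<bar>disp (take (Suc t) ts)\<bar> \<le> int r)"
    using tilt_walk_edge[OF ts b(1,2)] b(3)
    by (auto simp: walk_path_def tube_def length_bridge[OF ts b(1,2)])
  also have "\<dots> \<longleftrightarrow> (\<forall>t \<le> 2 * len k. \<bar>disp (take t ts)\<bar> \<le> int r)"
  proof safe
    fix t assume *: "\<forall>t < 2 * len k. \<bar>disp (take (Suc t) ts)\<bar> \<le> int r" and t: "t \<le> 2 * len k"
    show "\<bar>disp (take t ts)\<bar> \<le> int r"
    proof (cases t)
      case (Suc s)
      then show ?thesis using *[rule_format, of s] t by simp
    qed simp
  qed auto
  finally show ?thesis using ts by (simp add: tube_walks_iff)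
qed

lemma tilt_at_vertex:
  assumes "1 \<le> i" "1 \<le> j"
    and "e \<in> {Hor i j, Ver i j, Hor (i - 1) j, Ver i (j - 1)}"
    and "e' \<in> {Hor i j, Ver i j, Hor (i - 1) j, Ver i (j - 1)}"
  shows "\<bar>tilt e - tilt e'\<bar> \<le> 2"
  using assms by (auto simp: of_nat_diff)

lemma families_bridges:
  assumes "\<omega> \<in> walk_families" "k \<in> {1..K}"
  shows "\<omega> k \<in> bridges (len k)" "walk_path (len k) n (\<omega> k) \<subseteq> tube D r k"
proof -
  have "\<omega> k \<in> tube_walks (len k) (int r)" using assms by auto
  then show b: "\<omega> k \<in> bridges (len k)" using tube_walks_subset_bridges by auto
  show "walk_path (len k) n (\<omega> k) \<subseteq> tube D r k"
    using walk_path_in_tube_iff[OF assms(2) b] \<open>\<omega> k \<in> tube_walks (len k) (int r)\<close> by simp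
qed

lemma lines_state_visited:
  assumes \<omega>: "\<omega> \<in> walk_families" and k: "k \<in> {1..K}" and t: "0 < t" "t < 2 * len k"
    and ij: "walk_pos (len k) n (\<omega> k) t = (i, j)"
  shows "lines_state n K D \<omega> (Hor i j) \<longleftrightarrow> \<not> \<omega> k ! (t - 1)" "lines_state n K D \<omega> (Ver i j) \<longleftrightarrow> \<omega> k ! (t - 1)"
    "lines_state n K D \<omega> (Hor (i - 1) j) \<longleftrightarrow> \<not> \<omega> k ! t" "lines_state n K D \<omega> (Ver i (j - 1)) \<longleftrightarrow> \<omega> k ! t"
proof -
  note b = len_bounds[OF k]
  note f = families_bridges[OF \<omega>]
  have V: "(i, j) \<in> vertices n" using walk_pos_vertices[OF f(1)[OF k] b(1,2) t] ij by simp
  have pos: "1 \<le> i" "1 \<le> j" using V by (auto simp: vertices_def)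
  note p = walk_path_at_visited[OF f(1)[OF k] b(1,2) t ij]
  \<comment> \<open>The edge by which path \<open>k\<close> leaves the vertex. It lies in tube
    \<open>k\<close> and excludes all other tubes from this vertex.\<close>
  define e0 where "e0 = (if \<omega> k ! t then Hor (i - 1) j else Ver i (j - 1))"
  have e0: "e0 \<in> {Hor i j, Ver i j, Hor (i - 1) j, Ver i (j - 1)}" "e0 \<in> walk_path (len k) n (\<omega> k)"
    using p by (auto simp: e0_def)
  have *: "lines_state n K D \<omega> e \<longleftrightarrow> e \<notin> walk_path (len k) n (\<omega> k)"
    if e: "e \<in> {Hor i j, Ver i j, Hor (i - 1) j, Ver i (j - 1)}" for e
  proof -
    have "e \<in> edges n" using e V by (auto simp: vertices_def)
    moreover have "l = k" if "l \<in> {1..K}" "e \<in> walk_path (len l) n (\<omega> l)" for l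
      using tube_separation[of e l e0 k] f(2)[OF that(1)] f(2)[OF k] e0 that tilt_at_vertex[OF pos e e0(1)] by blast
    ultimately have "(\<exists>l \<in> {1..K}. e \<in> walk_path (len l) n (\<omega> l)) \<longleftrightarrow> e \<in> walk_path (len k) n (\<omega> k)"
      using k by blast
    then show ?thesis using \<open>e \<in> edges n\<close> by (simp add: lines_state_def)
  qed
  show "lines_state n K D \<omega> (Hor i j) \<longleftrightarrow> \<not> \<omega> k ! (t - 1)" "lines_state n K D \<omega> (Ver i j) \<longleftrightarrow> \<omega> k ! (t - 1)"
    "lines_state n K D \<omega> (Hor (i - 1) j) \<longleftrightarrow> \<not> \<omega> k ! t" "lines_state n K D \<omega> (Ver i (j - 1)) \<longleftrightarrow> \<omega> k ! t"
    using *[of "Hor i j"] *[of "Ver i j"] *[of "Hor (i - 1) j"] *[of "Ver i (j - 1)"] p by simp_all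
qed

text \<open>Going straight gives type b and turning gives type c; type a would need no path or two
  paths at the vertex.\<close>

lemma lines_state_type_visited:
  assumes \<omega>: "\<omega> \<in> walk_families" and k: "k \<in> {1..K}" and t: "0 < t" "t < 2 * len k"
  shows "if \<omega> k ! (t - 1) = \<omega> k ! t then type_b (lines_state n K D \<omega>) (walk_pos (len k) n (\<omega> k) t)
    else type_c (lines_state n K D \<omega>) (walk_pos (len k) n (\<omega> k) t)"
proof -
  obtain i j where ij: "walk_pos (len k) n (\<omega> k) t = (i, j)" by fastforce
  show ?thesis unfolding ij using lines_state_visited[OF \<omega> k t ij] by auto
qed

lemma lines_state_type_unvisited:
  assumes \<omega>: "\<omega> \<in> walk_families" and v: "v \<in> vertices n"
    and un: "\<And>k. k \<in> {1..K} \<Longrightarrow> v \<notin> walk_pos (len k) n (\<omega> k) ` {0<..<2 * len k}"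
  shows "type_a (lines_state n K D \<omega>) v"
proof -
  obtain i j where ij: "v = (i, j)" by (cases v)
  have pos: "1 \<le> i" "i \<le> n" "1 \<le> j" "j \<le> n" using v ij by (auto simp: vertices_def)
  have "lines_state n K D \<omega> e" if e: "lower_end e = (i, j) \<or> upper_end e = (i, j)" for e
  proof -
    have "e \<in> edges n" using e v ij by (auto simp: edges_def)
    moreover have "e \<notin> walk_path (len k) n (\<omega> k)" if k: "k \<in> {1..K}" for k
      using walk_path_at_unvisited[OF families_bridges(1)[OF \<omega> k] len_bounds(1,2)[OF k], of e v] e un[OF k] v ij
      by auto
    ultimately show ?thesis by (auto simp: lines_state_def)
  qed
  from this[of "Hor i j"] this[of "Ver i j"] this[of "Hor (i - 1) j"] this[of "Ver i (j - 1)"]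
  show ?thesis using pos ij by simp
qed

lemma lines_state_in_tube_states:
  assumes \<omega>: "\<omega> \<in> walk_families"
  shows "lines_state n K D \<omega> \<in> tube_states n K D r"
proof -
  let ?x = "lines_state n K D \<omega>"
  have "?x \<in> extensional (edges n)" by (auto simp: lines_state_def extensional_def)
  moreover have "type_a ?x v \<or> type_b ?x v \<or> type_c ?x v" if v: "v \<in> vertices n" for v
  proof (cases "\<exists>k \<in> {1..K}. v \<in> walk_pos (len k) n (\<omega> k) ` {0<..<2 * len k}")
    case True
    then obtain k t where "k \<in> {1..K}" "0 < t" "t < 2 * len k" "v = walk_pos (len k) n (\<omega> k) t"
      by auto
    then show ?thesis using lines_state_type_visited[OF \<omega>, of k t] by (auto split: if_splits)
  qed (use lines_state_type_unvisited[OF \<omega> v] in blast)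
  moreover have "?x e = lines_boundary n K D e" if e: "e \<in> dangling_edges n" for e
  proof -
    have "e \<in> walk_path (len k) n (\<omega> k) \<longleftrightarrow> e \<in> {Ver (len k) n, Hor 0 (k * D + 1)}" if k: "k \<in> {1..K}" for k
      using walk_path_dangling[OF families_bridges(1)[OF \<omega> k] len_bounds(1,2)[OF k]] e len_bounds(4)[OF k] by auto
    moreover have "e \<in> edges n" using e by (simp add: dangling_edges_def)
    ultimately show ?thesis by (auto simp: lines_state_def lines_boundary_def)
  qed
  moreover have "\<exists>k \<in> {1..K}. e \<in> tube D r k" if e: "e \<in> edges n" "\<not> ?x e" for e
  proof -
    obtain k where "k \<in> {1..K}" "e \<in> walk_path (len k) n (\<omega> k)"
      using e unfolding lines_state_def by auto
    then show ?thesis using families_bridges(2)[OF \<omega>] by blast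
  qed
  ultimately show ?thesis by (simp add: tube_states_def states_iff)
qed

text \<open>The two-in-two-out rule balances the \<open>False\<close> edges at each vertex. As a
  vertex meets at most one tube, the balance holds in each tube separately, and
  \<open>balanced_set_is_path\<close> yields one path per tube.\<close>

lemma tube_state_is_lines_state:
  assumes x: "x \<in> tube_states n K D r"
  shows "\<exists>\<omega> \<in> walk_families. x = lines_state n K D \<omega>"
proof -
  have ext: "x \<in> extensional (edges n)"
    and ty: "\<And>v. v \<in> vertices n \<Longrightarrow> type_a x v \<or> type_b x v \<or> type_c x v"
    and bd: "\<And>e. e \<in> dangling_edges n \<Longrightarrow> x e = lines_boundary n K D e"
    and tubes: "\<And>e. e \<in> edges n \<Longrightarrow> \<not> x e \<Longrightarrow> \<exists>k \<in> {1..K}. e \<in> tube D r k"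
    using x unfolding tube_states_def states_iff by blast+
  define P where "P k = {e \<in> edges n. \<not> x e \<and> e \<in> tube D r k}" for k
  have "\<exists>ts \<in> tube_walks (len k) (int r). P k = walk_path (len k) n ts" if k: "k \<in> {1..K}" for k
  proof -
    note b = len_bounds[OF k]
    have "\<exists>ts \<in> bridges (len k). P k = walk_path (len k) n ts"
    proof (rule balanced_set_is_path[OF b(1,2)])
      show "P k \<subseteq> edges n" by (auto simp: P_def)
      show "P k \<inter> dangling_edges n = {Ver (len k) n, Hor 0 (n - len k + 1)}"
      proof -
        have in_tube: "e \<in> tube D r l" if "e \<in> {Ver (len l) n, Hor 0 (l * D + 1)}" "l \<in> {1..K}" for e l
          using that len_bounds[OF that(2)] r by (auto simp: tube_def)
        have "e \<in> {Ver (len k) n, Hor 0 (k * D + 1)}" if e: "e \<in> P k" "e \<in> dangling_edges n" for e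
        proof -
          have "\<not> lines_boundary n K D e" using e bd[of e] by (simp add: P_def)
          then obtain l where l: "l \<in> {1..K}" "e \<in> {Ver (len l) n, Hor 0 (l * D + 1)}"
            unfolding lines_boundary_def by blast
          then have "l = k" using tube_separation[of e l e k] in_tube[of e l] e by (auto simp: P_def)
          then show ?thesis using l by simp
        qed
        moreover have "e \<in> P k \<inter> dangling_edges n" if e: "e \<in> {Ver (len k) n, Hor 0 (k * D + 1)}" for e
        proof -
          have d: "e \<in> dangling_edges n" using e b by auto
          moreover have "\<not> lines_boundary n K D e" using e k by (auto simp: lines_boundary_def)
          ultimately show ?thesis using bd[OF d] in_tube[OF e k] by (auto simp: P_def dangling_edges_def)
        qed
        ultimately show ?thesis unfolding b(4) by blast
      qed
      fix i j assume V: "(i, j) \<in> vertices n"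
      let ?I = "{Hor i j, Ver i j, Hor (i - 1) j, Ver i (j - 1)}"
      have pos: "1 \<le> i" "1 \<le> j" using V by (auto simp: vertices_def)
      have I: "e \<in> edges n" if "e \<in> ?I" for e using that V by (auto simp: vertices_def)
      show "of_bool (Hor i j \<in> P k) + of_bool (Ver i j \<in> P k) =
        (of_bool (Hor (i - 1) j \<in> P k) + of_bool (Ver i (j - 1) \<in> P k) :: nat)"
      proof (cases "\<exists>e0 \<in> ?I. e0 \<in> P k")
        case True
        then obtain e0 where e0: "e0 \<in> ?I" "e0 \<in> P k" by blast
        have eq: "e \<in> P k \<longleftrightarrow> \<not> x e" if e: "e \<in> ?I" for e
        proof
          assume "\<not> x e"
          then obtain l where l: "l \<in> {1..K}" "e \<in> tube D r l" using tubes[OF I[OF e]] by blast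
          then have "l = k"
            using tube_separation[of e l e0 k] tilt_at_vertex[OF pos e e0(1)] e0(2) by (auto simp: P_def)
          then show "e \<in> P k" using l I[OF e] \<open>\<not> x e\<close> by (simp add: P_def)
        qed (simp add: P_def)
        then have "Hor i j \<in> P k \<longleftrightarrow> \<not> x (Hor i j)" "Ver i j \<in> P k \<longleftrightarrow> \<not> x (Ver i j)"
          "Hor (i - 1) j \<in> P k \<longleftrightarrow> \<not> x (Hor (i - 1) j)" "Ver i (j - 1) \<in> P k \<longleftrightarrow> \<not> x (Ver i (j - 1))"
          by blast+
        then show ?thesis using ty[OF V] by auto
      qed auto
    qed
    then obtain ts where ts: "ts \<in> bridges (len k)" "P k = walk_path (len k) n ts" by blast
    moreover have "P k \<subseteq> tube D r k" by (auto simp: P_def)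
    ultimately show ?thesis using walk_path_in_tube_iff[OF k ts(1)] by auto
  qed
  then obtain f where f: "\<And>k. k \<in> {1..K} \<Longrightarrow> f k \<in> tube_walks (len k) (int r) \<and> P k = walk_path (len k) n (f k)"
    by metis
  define \<omega> where "\<omega> = restrict f {1..K}"
  have "\<omega> \<in> walk_families" using f by (auto simp: \<omega>_def)
  moreover have "x = lines_state n K D \<omega>"
  proof
    fix e
    show "x e = lines_state n K D \<omega> e"
    proof (cases "e \<in> edges n")
      case True
      have "\<not> x e \<longleftrightarrow> (\<exists>k \<in> {1..K}. e \<in> P k)" using tubes[OF True] True by (auto simp: P_def)
      also have "\<dots> \<longleftrightarrow> (\<exists>k \<in> {1..K}. e \<in> walk_path (len k) n (\<omega> k))" using f by (auto simp: \<omega>_def)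
      finally show ?thesis using True by (auto simp: lines_state_def)
    next
      case False
      then show ?thesis using ext by (simp add: lines_state_def extensional_def)
    qed
  qed
  ultimately show ?thesis by blast
qed

lemma lines_state_path:
  assumes \<omega>: "\<omega> \<in> walk_families" and k: "k \<in> {1..K}"
  shows "walk_path (len k) n (\<omega> k) = {e \<in> edges n. \<not> lines_state n K D \<omega> e \<and> e \<in> tube D r k}"
proof
  show "walk_path (len k) n (\<omega> k) \<subseteq> {e \<in> edges n. \<not> lines_state n K D \<omega> e \<and> e \<in> tube D r k}"
    using walk_path_edges[OF families_bridges(1)[OF \<omega> k] len_bounds(1,2)[OF k]] families_bridges(2)[OF \<omega> k] k
    by (auto simp: lines_state_def)
  show "{e \<in> edges n. \<not> lines_state n K D \<omega> e \<and> e \<in> tube D r k} \<subseteq> walk_path (len k) n (\<omega> k)"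
  proof
    fix e assume e: "e \<in> {e \<in> edges n. \<not> lines_state n K D \<omega> e \<and> e \<in> tube D r k}"
    then obtain l where l: "l \<in> {1..K}" "e \<in> walk_path (len l) n (\<omega> l)" by (auto simp: lines_state_def)
    then have "l = k" using tube_separation[of e l e k] families_bridges(2)[OF \<omega> l(1)] e by auto
    then show "e \<in> walk_path (len k) n (\<omega> k)" using l by simp
  qed
qed

lemma lines_state_bij: "bij_betw (lines_state n K D) walk_families (tube_states n K D r)"
  unfolding bij_betw_def
proof
  show "inj_on (lines_state n K D) walk_families"
  proof (rule inj_onI)
    fix \<omega> \<omega>' assume \<omega>: "\<omega> \<in> walk_families" "\<omega>' \<in> walk_families"
      and eq: "lines_state n K D \<omega> = lines_state n K D \<omega>'"
    show "\<omega> = \<omega>'"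
    proof (rule PiE_ext[OF \<omega>])
      fix k assume k: "k \<in> {1..K}"
      have "walk_path (len k) n (\<omega> k) = walk_path (len k) n (\<omega>' k)"
        using lines_state_path[OF \<omega>(1) k] lines_state_path[OF \<omega>(2) k] eq by simp
      then show "\<omega> k = \<omega>' k"
        using walk_path_inj families_bridges(1)[OF \<omega>(1) k] families_bridges(1)[OF \<omega>(2) k] len_bounds(1,2)[OF k]
        by blast
    qed
  qed
  show "lines_state n K D ` walk_families = tube_states n K D r"
    using lines_state_in_tube_states tube_state_is_lines_state by blast
qed

text \<open>Relative to the state with type a everywhere, only visited vertices contribute.
  Different tubes visit disjoint sets of vertices, so the weight factors over the paths.\<close>

lemma weight_lines_state:
  assumes \<omega>: "\<omega> \<in> walk_families" and a: "0 < a" and b: "b = a * (l * p)" and c: "c = a * (l * q)"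
  shows "weight a b c n (lines_state n K D \<omega>) =
    a ^ (n * n) * (\<Prod>k \<in> {1..K}. l ^ (2 * len k - 1) * walk_wt p q (\<omega> k))"
proof -
  let ?x = "lines_state n K D \<omega>"
  let ?U = "\<lambda>k. walk_pos (len k) n (\<omega> k) ` {0<..<2 * len k}"
  define g where "g v = vertex_weight a b c ?x v / a" for v
  have "weight a b c n ?x = (\<Prod>v \<in> vertices n. a * g v)"
    using a by (simp add: weight_eq_prod g_def)
  also have "\<dots> = a ^ (n * n) * (\<Prod>v \<in> vertices n. g v)"
    by (simp add: prod.distrib vertices_def)
  also have "(\<Prod>v \<in> vertices n. g v) = (\<Prod>v \<in> (\<Union>k \<in> {1..K}. ?U k). g v)"
  proof (rule prod.mono_neutral_right)
    show "(\<Union>k \<in> {1..K}. ?U k) \<subseteq> vertices n"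
      using walk_pos_vertices[OF families_bridges(1)[OF \<omega>] len_bounds(1,2)] by fastforce
    show "\<forall>v \<in> vertices n - (\<Union>k \<in> {1..K}. ?U k). g v = 1"
    proof
      fix v assume "v \<in> vertices n - (\<Union>k \<in> {1..K}. ?U k)"
      then have "type_a ?x v" by (intro lines_state_type_unvisited[OF \<omega>]) auto
      then show "g v = 1" using a by (simp add: g_def vertex_weight_type)
    qed
  qed simp
  also have "\<dots> = (\<Prod>k \<in> {1..K}. \<Prod>v \<in> ?U k. g v)"
  proof (rule prod.UNION_disjoint)
    have False if kl: "k \<in> {1..K}" "l \<in> {1..K}" "k \<noteq> l" and v: "v \<in> ?U k" "v \<in> ?U l" for k l v
    proof -
      have "\<exists>e \<in> tube D r k. lower_end e = v" if k: "k \<in> {1..K}" and v: "v \<in> ?U k" for k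
      proof -
        obtain t where t: "0 < t" "t < 2 * len k" "v = walk_pos (len k) n (\<omega> k) t" using v by auto
        let ?e = "walk_edge (len k) n (\<omega> k) (t - 1)"
        have "?e \<in> walk_path (len k) n (\<omega> k)"
          using t length_bridge[OF families_bridges(1)[OF \<omega> k] len_bounds(1,2)[OF k]] by (auto simp: walk_path_def)
        then have "?e \<in> tube D r k" using families_bridges(2)[OF \<omega> k] by blast
        moreover have "lower_end ?e = v" using t by simp
        ultimately show ?thesis by blast
      qed
      from this[OF kl(1) v(1)] this[OF kl(2) v(2)] obtain e e' where "e \<in> tube D r k" "e' \<in> tube D r l"
        "lower_end e = lower_end e'" by metis
      then show False using tube_separation[of e k e' l] kl by (simp add: tilt_def)
    qed
    then show "\<forall>i \<in> {1..K}. \<forall>j \<in> {1..K}. i \<noteq> j \<longrightarrow> ?U i \<inter> ?U j = {}" by blast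
  qed auto
  also have "\<dots> = (\<Prod>k \<in> {1..K}. l ^ (2 * len k - 1) * walk_wt p q (\<omega> k))"
  proof (rule prod.cong)
    fix k assume k: "k \<in> {1..K}"
    note f = families_bridges(1)[OF \<omega> k] len_bounds(1,2)[OF k]
    have "inj_on (\<lambda>s. walk_pos (len k) n (\<omega> k) (Suc s)) {..<2 * len k - 1}"
      by (rule inj_onI, rule Suc_inject, rule walk_pos_inj[OF f]) auto
    moreover have "?U k = (\<lambda>s. walk_pos (len k) n (\<omega> k) (Suc s)) ` {..<2 * len k - 1}"
    proof -
      have "{0<..<2 * len k} = Suc ` {..<2 * len k - 1}"
        by (auto simp: image_Suc_lessThan)
      then show ?thesis by (simp add: image_image)
    qed
    ultimately have "(\<Prod>v \<in> ?U k. g v) = (\<Prod>s < 2 * len k - 1. g (walk_pos (len k) n (\<omega> k) (Suc s)))"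
      by (simp add: prod.reindex)
    also have "\<dots> = (\<Prod>s < length (\<omega> k) - 1. if \<omega> k ! s = \<omega> k ! Suc s then l * p else l * q)"
    proof (rule prod.cong)
      fix s assume "s \<in> {..<length (\<omega> k) - 1}"
      then have "Suc s < 2 * len k" using length_bridge[OF f] by auto
      then show "g (walk_pos (len k) n (\<omega> k) (Suc s)) = (if \<omega> k ! s = \<omega> k ! Suc s then l * p else l * q)"
        using lines_state_type_visited[OF \<omega> k, of "Suc s"] a b c
        by (auto simp: g_def vertex_weight_type split: if_splits)
    qed (simp add: length_bridge[OF f])
    also have "\<dots> = l ^ (2 * len k - 1) * walk_wt p q (\<omega> k)"
      using prod_nth_walk_wt[of "\<omega> k" l p q] by (simp only: length_bridge[OF f])
    finally show "(\<Prod>v \<in> ?U k. g v) = l ^ (2 * len k - 1) * walk_wt p q (\<omega> k)" .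
  qed simp
  finally show ?thesis .
qed

text \<open>A directed cell always contains an edge pointing left or down, hence an edge of some
  path \<open>k\<close>. Tilts within a cell differ by at most 2, so an edge of the cell outside the
  tubes forces path \<open>k\<close> to within 2 of the boundary of its tube.\<close>

lemma boundary_state_near:
  assumes \<omega>: "\<omega> \<in> walk_families" and q: "q \<in> cells n"
    and cyc: "directed_cycle (lines_state n K D \<omega>) q"
    and out: "reverse_cell (lines_state n K D \<omega>) q \<notin> tube_states n K D r"
  shows "\<exists>k \<in> {1..K}. \<exists>t \<le> 2 * len k. int r - 2 \<le> \<bar>disp (take t (\<omega> k))\<bar>"
proof -
  let ?x = "lines_state n K D \<omega>"
  have x: "?x \<in> tube_states n K D r" by (rule lines_state_in_tube_states[OF \<omega>])
  then have "?x \<in> states n (lines_boundary n K D)" by (simp add: tube_states_def)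
  then have "reverse_cell ?x q \<in> states n (lines_boundary n K D)"
    using reverse_cell_in_states q cyc by blast
  then obtain e where e: "e \<in> edges n" "\<not> reverse_cell ?x q e" "\<And>k. k \<in> {1..K} \<Longrightarrow> e \<notin> tube D r k"
    using out by (auto simp: tube_states_def)
  have "e \<in> cell_edges q"
    using e x by (auto simp: reverse_cell_def tube_states_def split: if_splits)
  obtain i j where ij: "q = (i, j)" by (cases q)
  have "\<exists>e0 \<in> cell_edges q. \<not> ?x e0" using cyc ij by auto
  then obtain e0 where e0: "e0 \<in> cell_edges q" "\<not> ?x e0" by blast
  have "e0 \<in> edges n" using e0(1) q ij by (auto simp: cells_def)
  then obtain k where k: "k \<in> {1..K}" "e0 \<in> walk_path (len k) n (\<omega> k)"
    using e0(2) by (auto simp: lines_state_def)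
  note f = families_bridges(1)[OF \<omega> k(1)] len_bounds(1,2)[OF k(1)]
  obtain t where t: "t < 2 * len k" "e0 = walk_edge (len k) n (\<omega> k) t"
    using k(2) length_bridge[OF f] by (auto simp: walk_path_def)
  have "\<bar>tilt e - tilt e0\<bar> \<le> 2" using \<open>e \<in> cell_edges q\<close> e0(1) ij by auto
  moreover have "\<not> \<bar>tilt e - int (k * D + 1)\<bar> \<le> int r" using e(3)[OF k(1)] by (simp add: tube_def)
  moreover have "tilt e0 = int (k * D + 1) + disp (take (Suc t) (\<omega> k))"
    using tilt_walk_edge[OF f t(1)] t(2) len_bounds(3)[OF k(1)] by simp
  ultimately have "int r - 2 \<le> \<bar>disp (take (Suc t) (\<omega> k))\<bar>" by linarith
  then show ?thesis using t k by (intro bexI[of _ k] exI[of _ "Suc t"]) auto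
qed

text \<open>Sums over families of walks factor into products over \<open>k\<close>. For the
  boundary, a union bound over \<open>k\<close> restricts one factor at a time, which costs that
  factor \<open>\<epsilon>\<close>.\<close>

lemma tube_states_weights:
  assumes pq: "0 < p" "0 < q" "p + q = 1" and a: "0 < a" and l: "0 < l" "l \<le> 1"
    and b: "b = a * (l * p)" and c: "c = a * (l * q)" and \<epsilon>: "0 \<le> \<epsilon>"
    and near: "\<And>k. k \<in> {1..K} \<Longrightarrow>
      (\<Sum>ts | ts \<in> tube_walks (len k) (int r) \<and> (\<exists>t \<le> 2 * len k. int r - 2 \<le> \<bar>disp (take t ts)\<bar>). walk_wt p q ts) \<le>
      \<epsilon> * (\<Sum>ts \<in> tube_walks (len k) (int r). walk_wt p q ts)"
  shows "sum (weight a b c n) {x \<in> tube_states n K D r.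
      \<exists>q \<in> cells n. directed_cycle x q \<and> reverse_cell x q \<notin> tube_states n K D r} \<le>
      real K * \<epsilon> * sum (weight a b c n) (tube_states n K D r)" (is ?boundary)
    and "n + 2 * (K * D) + 1 \<le> 2 * n \<Longrightarrow>
      sum (weight a b c n) (tube_states n K D r) \<le> a ^ (n * n) * l ^ (n * K)" (is "_ \<Longrightarrow> ?total")
proof -
  let ?A = "\<lambda>k. tube_walks (len k) (int r)"
  let ?near = "\<lambda>k ts. \<exists>t \<le> 2 * len k. int r - 2 \<le> \<bar>disp (take t ts)\<bar>"
  define h where "h k ts = l ^ (2 * len k - 1) * walk_wt p q ts" for k ts
  define G where "G k = (\<Sum>ts \<in> ?A k. h k ts)" for k
  have w: "weight a b c n (lines_state n K D \<omega>) = a ^ (n * n) * (\<Prod>k \<in> {1..K}. h k (\<omega> k))" if "\<omega> \<in> walk_families" for \<omega>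
    using weight_lines_state[OF that a b c] by (simp add: h_def)
  have h0: "0 \<le> h k ts" for k ts
    using walk_wt_pos[OF pq, of ts] l by (simp add: h_def)
  have G0: "0 \<le> G k" for k unfolding G_def by (rule sum_nonneg) (simp add: h0)
  have finF: "finite walk_families" by (intro finite_PiE) auto
  have total: "sum (weight a b c n) (tube_states n K D r) = a ^ (n * n) * (\<Prod>k \<in> {1..K}. G k)"
  proof -
    have "sum (weight a b c n) (tube_states n K D r) = (\<Sum>\<omega> \<in> walk_families. weight a b c n (lines_state n K D \<omega>))"
      using sum.reindex_bij_betw[OF lines_state_bij] by metis
    also have "\<dots> = (\<Sum>\<omega> \<in> walk_families. a ^ (n * n) * (\<Prod>k \<in> {1..K}. h k (\<omega> k)))"
      by (rule sum.cong) (use w in auto)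
    also have "\<dots> = a ^ (n * n) * (\<Prod>k \<in> {1..K}. G k)"
      unfolding G_def sum_distrib_left[symmetric] by (subst prod_sum_PiE) auto
    finally show ?thesis .
  qed
  show ?boundary
  proof -
    let ?B = "{x \<in> tube_states n K D r. \<exists>q \<in> cells n. directed_cycle x q \<and> reverse_cell x q \<notin> tube_states n K D r}"
    let ?F = "\<lambda>k. {\<omega> \<in> walk_families. ?near k (\<omega> k)}"
    have sub: "?B \<subseteq> lines_state n K D ` (\<Union>k \<in> {1..K}. ?F k)"
    proof
      fix x assume x: "x \<in> ?B"
      then obtain \<omega> where \<omega>: "\<omega> \<in> walk_families" "x = lines_state n K D \<omega>"
        using tube_state_is_lines_state by blast
      then have "\<exists>k \<in> {1..K}. ?near k (\<omega> k)" using boundary_state_near[OF \<omega>(1)] x by blast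
      then show "x \<in> lines_state n K D ` (\<Union>k \<in> {1..K}. ?F k)" using \<omega> by blast
    qed
    have finFk: "finite (?F k)" for k by (rule finite_subset[OF _ finF]) auto
    have wn: "0 \<le> weight a b c n x" for x
      by (rule less_imp_le, rule weight_pos) (use a b c l pq in auto)
    have "sum (weight a b c n) ?B \<le> sum (weight a b c n) (lines_state n K D ` (\<Union>k \<in> {1..K}. ?F k))"
    proof (rule sum_mono2[OF _ sub])
      show "finite (lines_state n K D ` (\<Union>k \<in> {1..K}. ?F k))"
        using finFk by blast
    qed (use wn in auto)
    also have "\<dots> \<le> (\<Sum>k \<in> {1..K}. sum (\<lambda>\<omega>. weight a b c n (lines_state n K D \<omega>)) (?F k))"
    proof -
      have "inj_on (lines_state n K D) (\<Union>k \<in> {1..K}. ?F k)"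
        by (rule inj_on_subset[OF bij_betw_imp_inj_on[OF lines_state_bij]]) auto
      then show ?thesis
        using sum_UN_le[of "{1..K}" ?F "\<lambda>\<omega>. weight a b c n (lines_state n K D \<omega>)"] finFk wn
        by (simp add: sum.reindex)
    qed
    also have "\<dots> \<le> (\<Sum>k \<in> {1..K}. \<epsilon> * (a ^ (n * n) * (\<Prod>k \<in> {1..K}. G k)))"
    proof (rule sum_mono)
      fix k assume k: "k \<in> {1..K}"
      let ?A' = "\<lambda>j. if j = k then {ts \<in> ?A k. ?near k ts} else ?A j"
      have F: "?F k = Pi\<^sub>E {1..K} ?A'" by (rule PiE_filter[OF k])
      have "(\<Sum>\<omega> \<in> ?F k. weight a b c n (lines_state n K D \<omega>)) =
          (\<Sum>\<omega> \<in> Pi\<^sub>E {1..K} ?A'. a ^ (n * n) * (\<Prod>k \<in> {1..K}. h k (\<omega> k)))"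
        unfolding F[symmetric] by (rule sum.cong) (use w in auto)
      also have "\<dots> = a ^ (n * n) * (\<Prod>j \<in> {1..K}. \<Sum>ts \<in> ?A' j. h j ts)"
        unfolding sum_distrib_left[symmetric] by (subst prod_sum_PiE) auto
      also have "\<dots> \<le> a ^ (n * n) * (\<Prod>j \<in> {1..K}. (if j = k then \<epsilon> else 1) * G j)"
      proof (rule mult_left_mono[OF prod_mono])
        fix j assume j: "j \<in> {1..K}"
        have "(\<Sum>ts \<in> {ts \<in> ?A k. ?near k ts}. h k ts) \<le> \<epsilon> * G k"
          unfolding G_def h_def sum_distrib_left[symmetric] mult.left_commute[of \<epsilon>]
          by (rule mult_left_mono[OF near[OF k]]) (use l in simp)
        then show "0 \<le> (\<Sum>ts \<in> ?A' j. h j ts) \<and> (\<Sum>ts \<in> ?A' j. h j ts) \<le> (if j = k then \<epsilon> else 1) * G j"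
          using h0 by (auto simp: G_def intro!: sum_nonneg)
      qed (use a in simp)
      also have "(\<Prod>j \<in> {1..K}. (if j = k then \<epsilon> else 1) * G j) = \<epsilon> * (\<Prod>j \<in> {1..K}. G j)"
        using k by (simp add: prod.distrib)
      finally show "(\<Sum>\<omega> \<in> ?F k. weight a b c n (lines_state n K D \<omega>)) \<le> \<epsilon> * (a ^ (n * n) * (\<Prod>k \<in> {1..K}. G k))"
        by (simp only: mult.left_commute)
    qed
    also have "\<dots> = real K * \<epsilon> * sum (weight a b c n) (tube_states n K D r)"
      by (simp add: total)
    finally show ?thesis .
  qed
  show ?total if n: "n + 2 * (K * D) + 1 \<le> 2 * n"
  proof -
    have "(\<Prod>k \<in> {1..K}. G k) \<le> (\<Prod>k \<in> {1..K}. l ^ n)"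
    proof (rule prod_mono)
      fix k assume k: "k \<in> {1..K}"
      \<comment> \<open>Dropping the tube and the end condition leaves the full law of the walk
        after its first step, of total mass 1.\<close>
      have "?A k \<subseteq> Cons False ` bool_lists (2 * len k - 1)"
      proof
        fix ts assume "ts \<in> ?A k"
        then show "ts \<in> Cons False ` bool_lists (2 * len k - 1)"
          using len_bounds(1)[OF k] by (cases ts) (auto simp: tube_walks_def)
      qed
      then have "(\<Sum>ts \<in> ?A k. walk_wt p q ts) \<le> (\<Sum>ts \<in> Cons False ` bool_lists (2 * len k - 1). walk_wt p q ts)"
        by (intro sum_mono2) (use walk_wt_pos[OF pq] in \<open>auto simp: less_imp_le\<close>)
      also have "\<dots> = 1" using walk_wt_sum[OF pq] by (simp add: sum.reindex)
      finally have "G k \<le> l ^ (2 * len k - 1)"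
        using l by (simp add: G_def h_def mult_left_le flip: sum_distrib_left)
      also have "\<dots> \<le> l ^ n"
      proof (rule power_decreasing)
        have "k * D \<le> K * D" using k by simp
        then show "n \<le> 2 * len k - 1" using n by linarith
      qed (use l in auto)
      finally show "0 \<le> G k \<and> G k \<le> l ^ n" using G0 by simp
    qed
    also have "\<dots> = l ^ (n * K)" by (simp add: power_mult)
    finally show ?thesis unfolding total using a by (intro mult_left_mono) auto
  qed
qed

end

section \<open>A tightly packed state\<close>

text \<open>Counts the exits on the left side in rows up to \<open>y\<close> and equally, by the
  symmetric placement, the entries at the top in the last \<open>y\<close> columns. One function
  therefore serves both ends of the paths.\<close>

definition entries :: "nat \<Rightarrow> nat \<Rightarrow> nat \<Rightarrow> nat" where
  "entries K D y = card {k \<in> {1..K}. k * D < y}"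

text \<open>
  Faces are named by their lower left corners. \<open>packed_height n K D i j\<close> is the number of paths below and
  to the right of the face \<open>(i, j)\<close> when the paths first run straight to the main diagonal and then
  follow it side by side.
\<close>

definition packed_height :: "nat \<Rightarrow> nat \<Rightarrow> nat \<Rightarrow> nat \<Rightarrow> nat \<Rightarrow> nat" where
  "packed_height n K D i j = min (entries K D (min (n - i) j)) (j - i)"

text \<open>The paths are the level lines of the height: an edge is on a path iff the heights of the
  two faces that it separates differ.\<close>

definition packed_state :: "nat \<Rightarrow> nat \<Rightarrow> nat \<Rightarrow> orientation" where
  "packed_state n K D = (\<lambda>e. if e \<in> edges n then
     (case e of Hor i j \<Rightarrow> packed_height n K D i j = packed_height n K D i (j - 1)
      | Ver i j \<Rightarrow> packed_height n K D (i - 1) j = packed_height n K D i j) else undefined)"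

text \<open>At each change record the smaller of the two neighbouring values; by monotonicity these
  are distinct, and they lie below \<open>K\<close>.\<close>

lemma card_change_points:
  fixes f :: "nat \<Rightarrow> nat"
  assumes mono: "mono f \<or> antimono f" and le: "\<And>i. f i \<le> K" and I: "0 \<notin> I"
  shows "card {i \<in> I. f (i - 1) \<noteq> f i} \<le> K"
proof -
  let ?C = "{i \<in> I. f (i - 1) \<noteq> f i}"
  let ?g = "\<lambda>i. min (f (i - 1)) (f i)"
  have ordered: "?g i \<noteq> ?g i'" if "i \<in> ?C" "i' \<in> ?C" "i < i'" for i i'
  proof -
    have le: "i - 1 \<le> i" "i \<le> i' - 1" "i' - 1 \<le> i'" using that by auto
    from mono show ?thesis
    proof
      assume m: "mono f"
      show ?thesis using monoD[OF m le(1)] monoD[OF m le(2)] monoD[OF m le(3)] that by auto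
    next
      assume m: "antimono f"
      show ?thesis using antimonoD[OF m le(1)] antimonoD[OF m le(2)] antimonoD[OF m le(3)] that by auto
    qed
  qed
  have "inj_on ?g ?C"
  proof (rule inj_onI)
    fix i i' assume "i \<in> ?C" "i' \<in> ?C" "?g i = ?g i'"
    then show "i = i'" using ordered[of i i'] ordered[of i' i] by (metis nat_neq_iff)
  qed
  moreover have "?g ` ?C \<subseteq> {..<K}"
  proof
    fix y assume "y \<in> ?g ` ?C"
    then obtain i where "f (i - 1) \<noteq> f i" "y = ?g i" by auto
    then show "y \<in> {..<K}" using le[of i] le[of "i - 1"] by (auto simp: min_def split: if_splits)
  qed
  ultimately show ?thesis using card_inj_on_le[of ?g ?C "{..<K}"] by simp
qed

text \<open>\<open>s\<close>, \<open>t\<close>, \<open>p\<close>, \<open>q\<close> are the heights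
  of the upper left, upper right, lower left and lower right faces at a vertex. The difference of
  \<open>s\<close> and \<open>q\<close> is the number of paths through the vertex: 0 or 2 gives type
  a, 1 gives type b or c.\<close>

lemma six_patterns:
  fixes p q s t :: nat
  assumes "s = t \<or> s = Suc t" "t = q \<or> t = Suc q" "s = p \<or> s = Suc p" "p = q \<or> p = Suc q"
  shows "(s = p \<and> t = q \<and> p = q \<and> s = t \<or> s \<noteq> p \<and> t \<noteq> q \<and> p \<noteq> q \<and> s \<noteq> t) \<or>
    (s = p \<and> t = q \<and> p \<noteq> q \<and> s \<noteq> t \<or> s \<noteq> p \<and> t \<noteq> q \<and> p = q \<and> s = t) \<or>
    (s = p \<and> t \<noteq> q \<and> p \<noteq> q \<and> s = t \<or> s \<noteq> p \<and> t = q \<and> p = q \<and> s \<noteq> t)"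
    and "\<not> (s = p \<and> t = q \<and> p = q \<and> s = t \<or> s \<noteq> p \<and> t \<noteq> q \<and> p \<noteq> q \<and> s \<noteq> t) \<Longrightarrow> s = Suc q"
  using assms by (elim disjE; simp)+

context
  fixes n K D :: nat
  assumes D: "1 \<le> D"
begin

abbreviation "ht i j \<equiv> packed_height n K D i j"

lemma entries_mono: "y \<le> z \<Longrightarrow> entries K D y \<le> entries K D z"
  unfolding entries_def by (intro card_mono) auto

lemma entries_le: "entries K D y \<le> K" "entries K D y \<le> y"
proof -
  have "entries K D y \<le> card {1..K}" unfolding entries_def by (rule card_mono) auto
  then show "entries K D y \<le> K" by simp
  have "k < y" if "k * D < y" for k
    using that le_less_trans[OF mult_le_mono2[OF D, of k]] by simp
  then have "{k \<in> {1..K}. k * D < y} \<subseteq> {..<y}" by auto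
  then show "entries K D y \<le> y" unfolding entries_def using card_mono[of "{..<y}"] by fastforce
qed

lemma entries_Suc:
  "entries K D (Suc y) = entries K D y + of_bool (\<exists>k \<in> {1..K}. k * D = y)"
proof (cases "\<exists>k \<in> {1..K}. k * D = y")
  case True
  then obtain k where k: "k \<in> {1..K}" "k * D = y" by blast
  have "{k \<in> {1..K}. k * D < Suc y} = insert k {k \<in> {1..K}. k * D < y}"
    using k D by (auto simp: less_Suc_eq)
  then show ?thesis using True k by (simp add: entries_def)
next
  case False
  then have "{k \<in> {1..K}. k * D < Suc y} = {k \<in> {1..K}. k * D < y}" by (auto simp: less_Suc_eq)
  then show ?thesis using False by (simp add: entries_def)
qed

lemma entries_step: "z \<le> Suc y \<Longrightarrow> entries K D z \<le> Suc (entries K D y)"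
  using entries_mono[of z "Suc y"] entries_Suc[of y] by (simp add: of_bool_def split: if_splits)

lemma entries_full: "K * D < y \<Longrightarrow> entries K D y = K"
proof -
  assume y: "K * D < y"
  have "k * D < y" if "k \<in> {1..K}" for k
    using that y le_less_trans[OF mult_le_mono1[of k K D]] by simp
  then have "{k \<in> {1..K}. k * D < y} = {1..K}" by auto
  then show ?thesis by (simp add: entries_def)
qed

lemma ht_antimono: "antimono (\<lambda>i. ht i j)"
  unfolding packed_height_def
  by (rule antimonoI, rule min.mono[OF entries_mono]) auto

lemma ht_mono: "mono (\<lambda>j. ht i j)"
  unfolding packed_height_def
  by (rule monoI, rule min.mono[OF entries_mono]) auto

lemma ht_le: "ht i j \<le> K"
  using entries_le(1) by (simp add: packed_height_def min.coboundedI1)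

lemma ht_steps:
  shows "ht i j \<le> ht (i - 1) j" "ht (i - 1) j \<le> Suc (ht i j)"
    "ht i (j - 1) \<le> ht i j" "ht i j \<le> Suc (ht i (j - 1))"
proof -
  show "ht i j \<le> ht (i - 1) j" using antimonoD[OF ht_antimono, of "i - 1" i] by simp
  show "ht i (j - 1) \<le> ht i j" using monoD[OF ht_mono, of "j - 1" j] by simp
  have "entries K D (min (n - (i - 1)) j) \<le> Suc (entries K D (min (n - i) j))" by (rule entries_step) auto
  moreover have "j - (i - 1) \<le> Suc (j - i)" by simp
  ultimately show "ht (i - 1) j \<le> Suc (ht i j)" unfolding packed_height_def min_Suc_Suc[symmetric] by (rule min.mono)
  have "entries K D (min (n - i) j) \<le> Suc (entries K D (min (n - i) (j - 1)))" by (rule entries_step) auto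
  moreover have "j - i \<le> Suc (j - 1 - i)" by simp
  ultimately show "ht i j \<le> Suc (ht i (j - 1))" unfolding packed_height_def min_Suc_Suc[symmetric] by (rule min.mono)
qed

lemma packed_state_type:
  assumes "(i, j) \<in> vertices n"
  shows "type_a (packed_state n K D) (i, j) \<or> type_b (packed_state n K D) (i, j) \<or> type_c (packed_state n K D) (i, j)"
    and "\<not> type_a (packed_state n K D) (i, j) \<Longrightarrow> ht (i - 1) j = Suc (ht i (j - 1))"
proof -
  have e: "packed_state n K D (Hor i j) \<longleftrightarrow> ht i j = ht i (j - 1)"
    "packed_state n K D (Hor (i - 1) j) \<longleftrightarrow> ht (i - 1) j = ht (i - 1) (j - 1)"
    "packed_state n K D (Ver i j) \<longleftrightarrow> ht (i - 1) j = ht i j"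
    "packed_state n K D (Ver i (j - 1)) \<longleftrightarrow> ht (i - 1) (j - 1) = ht i (j - 1)"
    using assms by (auto simp: packed_state_def vertices_def)
  have s: "ht (i - 1) j = ht i j \<or> ht (i - 1) j = Suc (ht i j)"
    "ht i j = ht i (j - 1) \<or> ht i j = Suc (ht i (j - 1))"
    "ht (i - 1) j = ht (i - 1) (j - 1) \<or> ht (i - 1) j = Suc (ht (i - 1) (j - 1))"
    "ht (i - 1) (j - 1) = ht i (j - 1) \<or> ht (i - 1) (j - 1) = Suc (ht i (j - 1))"
    using ht_steps[of i j] ht_steps(1,2)[of i "j - 1"] ht_steps(3,4)[of "i - 1" j] by linarith+
  show "type_a (packed_state n K D) (i, j) \<or> type_b (packed_state n K D) (i, j) \<or> type_c (packed_state n K D) (i, j)"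
    unfolding type_a.simps type_b.simps type_c.simps e by (rule six_patterns(1)[OF s])
  show "\<not> type_a (packed_state n K D) (i, j) \<Longrightarrow> ht (i - 1) j = Suc (ht i (j - 1))"
    unfolding type_a.simps e by (rule six_patterns(2)[OF s])
qed

text \<open>The height vanishes on the right and at the bottom. On the left and at the top the bound
  \<open>entries K D y \<le> y\<close> reduces it to \<open>entries\<close>, which jumps exactly at
  the prescribed exits and entries.\<close>

lemma packed_state_in_states:
  assumes KD: "K * D < n"
  shows "packed_state n K D \<in> states n (lines_boundary n K D)"
proof -
  have "packed_state n K D e = lines_boundary n K D e" if e: "e \<in> dangling_edges n" for e
  proof (cases e)
    case (Hor i j)
    then have ij: "i = 0 \<or> i = n" "1 \<le> j" "j \<le> n" using e by auto
    have st: "packed_state n K D e \<longleftrightarrow> ht i j = ht i (j - 1)" using Hor ij by (auto simp: packed_state_def)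
    show ?thesis
    proof (cases "i = 0")
      case True
      have "ht 0 y = entries K D y" if "y \<le> n" for y using that entries_le(2)[of y] by (simp add: packed_height_def)
      then have "packed_state n K D e \<longleftrightarrow> entries K D (Suc (j - 1)) = entries K D (j - 1)"
        using st True ij by simp
      also have "\<dots> \<longleftrightarrow> \<not> (\<exists>k \<in> {1..K}. k * D = j - 1)" unfolding entries_Suc by simp
      also have "\<dots> \<longleftrightarrow> lines_boundary n K D e" using Hor True ij by (auto simp: lines_boundary_def)
      finally show ?thesis by simp
    next
      case False
      then show ?thesis using st ij Hor by (auto simp: packed_height_def lines_boundary_def)
    qed
  next
    case (Ver i j)
    then have ij: "j = 0 \<or> j = n" "1 \<le> i" "i \<le> n" using e by auto
    have st: "packed_state n K D e \<longleftrightarrow> ht (i - 1) j = ht i j" using Ver ij by (auto simp: packed_state_def)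
    show ?thesis
    proof (cases "j = 0")
      case True
      then show ?thesis using st ij Ver by (auto simp: packed_height_def lines_boundary_def)
    next
      case False
      have "ht y n = entries K D (n - y)" for y using entries_le(2)[of "n - y"] by (simp add: packed_height_def)
      moreover have "n - (i - 1) = Suc (n - i)" using ij by simp
      ultimately have "packed_state n K D e \<longleftrightarrow> entries K D (Suc (n - i)) = entries K D (n - i)"
        using st False ij by simp
      also have "\<dots> \<longleftrightarrow> \<not> (\<exists>k \<in> {1..K}. k * D = n - i)" unfolding entries_Suc by simp
      also have "\<dots> \<longleftrightarrow> \<not> (\<exists>k \<in> {1..K}. i = n - k * D)"
      proof -
        have "k * D = n - i \<longleftrightarrow> i = n - k * D" if "k \<in> {1..K}" for k
        proof -
          have "k * D < n" using that KD le_less_trans[OF mult_le_mono1[of k K D]] by simp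
          then show ?thesis using ij by auto
        qed
        then show ?thesis by blast
      qed
      also have "\<dots> \<longleftrightarrow> lines_boundary n K D e" using Ver False ij by (auto simp: lines_boundary_def)
      finally show ?thesis by simp
    qed
  qed
  moreover have "packed_state n K D \<in> extensional (edges n)" by (simp add: packed_state_def extensional_def)
  ultimately show ?thesis using packed_state_type(1) unfolding states_iff by (metis surj_pair)
qed

text \<open>Heights across a vertex can differ only if the height changes along its column or its
  row, and each row or column has at most \<open>K\<close> changes.\<close>

lemma packed_steps_in_box:
  assumes I: "finite I" "0 \<notin> I"
  shows "card {(i, j) \<in> I \<times> I. ht (i - 1) j \<noteq> ht i (j - 1)} \<le> 2 * (card I * K)"
proof -
  let ?A = "SIGMA i:I. {j \<in> I. ht i (j - 1) \<noteq> ht i j}"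
  let ?B = "SIGMA j:I. {i \<in> I. ht (i - 1) j \<noteq> ht i j}"
  have "{(i, j) \<in> I \<times> I. ht (i - 1) j \<noteq> ht i (j - 1)} \<subseteq> ?A \<union> prod.swap ` ?B"
    by (auto simp: image_iff)
  then have "card {(i, j) \<in> I \<times> I. ht (i - 1) j \<noteq> ht i (j - 1)} \<le> card (?A \<union> prod.swap ` ?B)"
    using I by (intro card_mono) auto
  also have "\<dots> \<le> card ?A + card (prod.swap ` ?B)" by (rule card_Un_le)
  also have "card (prod.swap ` ?B) \<le> card ?B" using I by (intro card_image_le) auto
  also have "card ?A = (\<Sum>i \<in> I. card {j \<in> I. ht i (j - 1) \<noteq> ht i j})"
    using I by (intro card_SigmaI) auto
  also have "\<dots> \<le> (\<Sum>i \<in> I. K)"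
    by (intro sum_mono card_change_points[OF disjI1[OF ht_mono] ht_le I(2)])
  also have "card ?B = (\<Sum>j \<in> I. card {i \<in> I. ht (i - 1) j \<noteq> ht i j})"
    using I by (intro card_SigmaI) auto
  also have "\<dots> \<le> (\<Sum>j \<in> I. K)"
    by (intro sum_mono card_change_points[OF disjI2[OF ht_antimono] ht_le I(2)])
  finally show ?thesis by simp
qed

lemma packed_state_non_a:
  assumes KD: "K * D < n"
  shows "card {v \<in> vertices n. \<not> type_a (packed_state n K D) v} \<le> 2 * n + 4 * ((K * D + 1) * K)"
proof -
  let ?I = "{n - K * D..n}" and ?J = "{1..K * D + 1}"
  let ?box = "\<lambda>I. {(i, j) \<in> I \<times> I. ht (i - 1) j \<noteq> ht i (j - 1)}"
  let ?diag = "\<lambda>d. (\<lambda>i. (i, i + d)) ` {1..n}"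
  have "{v \<in> vertices n. \<not> type_a (packed_state n K D) v} \<subseteq> (?diag 0 \<union> ?diag K) \<union> (?box ?I \<union> ?box ?J)"
  proof
    fix v assume v: "v \<in> {v \<in> vertices n. \<not> type_a (packed_state n K D) v}"
    obtain i j where [simp]: "v = (i, j)" by (cases v)
    have ij: "1 \<le> i" "i \<le> n" "1 \<le> j" "j \<le> n" using v by (auto simp: vertices_def)
    have step: "ht (i - 1) j = Suc (ht i (j - 1))" using packed_state_type(2)[of i j] v by simp
    moreover have "ht (i - 1) j \<le> j - (i - 1)" by (simp add: packed_height_def)
    ultimately have "j - (i - 1) > 0" by linarith
    then have "i \<le> j" using ij by simp
    show "v \<in> (?diag 0 \<union> ?diag K) \<union> (?box ?I \<union> ?box ?J)"
    proof (cases "K * D < n - i \<and> K * D < j - 1")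
      case True
      \<comment> \<open>Here all paths run in the bundle and the height depends on
        \<open>j - i\<close> only. Strictly inside the bundle two paths share the vertex, so exactly
        one path passes only on its two border diagonals.\<close>
      then have "ht (i - 1) j = min K (j - (i - 1))" "ht i (j - 1) = min K (j - 1 - i)"
        unfolding packed_height_def by (auto intro!: arg_cong2[where f = min] entries_full)
      then have "j = i \<or> j = i + K" using step \<open>i \<le> j\<close> ij by (auto simp: min_def split: if_splits)
      then show ?thesis using ij by auto
    next
      case False
      \<comment> \<open>The remaining vertices lie in a square at the upper right or the lower left
        corner, because \<open>i \<le> j\<close>.\<close>
      then have "i \<in> ?I \<and> j \<in> ?I \<or> i \<in> ?J \<and> j \<in> ?J" using ij \<open>i \<le> j\<close> by auto
      then show ?thesis using step by auto
    qed
  qed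
  then have "card {v \<in> vertices n. \<not> type_a (packed_state n K D) v} \<le> card ((?diag 0 \<union> ?diag K) \<union> (?box ?I \<union> ?box ?J))"
    by (intro card_mono) (auto intro: finite_subset[of _ "?I \<times> ?I"] finite_subset[of _ "?J \<times> ?J"])
  also have "\<dots> \<le> (card (?diag 0) + card (?diag K)) + (card (?box ?I) + card (?box ?J))"
    by (meson add_mono card_Un_le le_trans)
  also have "\<dots> \<le> (n + n) + (2 * (card ?I * K) + 2 * (card ?J * K))"
  proof -
    have "card (?diag d) \<le> n" for d using card_image_le[of "{1..n}" "\<lambda>i. (i, i + d)"] by simp
    from this[of 0] this[of K] show ?thesis using KD by (intro add_mono packed_steps_in_box) auto
  qed
  also have "\<dots> = 2 * n + 4 * ((K * D + 1) * K)" using KD by simp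
  finally show ?thesis .
qed

lemma packed_state_weight:
  assumes KD: "K * D < n" and M: "2 * n + 4 * ((K * D + 1) * K) \<le> M"
    and abc: "0 < a" and w: "0 < w" "w \<le> 1" "a * w \<le> b" "a * w \<le> c"
  shows "a ^ (n * n) * w ^ M \<le> weight a b c n (packed_state n K D)"
proof -
  let ?x = "packed_state n K D"
  have "a ^ (n * n) * w ^ M \<le> a ^ (n * n) * w ^ card {v \<in> vertices n. \<not> type_a ?x v}"
    using abc w packed_state_non_a[OF KD] M by (intro mult_left_mono power_decreasing) auto
  also have "\<dots> = (\<Prod>v \<in> vertices n. a * (if type_a ?x v then 1 else w))"
    by (simp add: prod.distrib prod.If_cases vertices_def Collect_conj_eq Int_commute Collect_neg_eq)
  also have "\<dots> \<le> (\<Prod>v \<in> vertices n. vertex_weight a b c ?x v)"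
  proof (rule prod_mono)
    fix v assume v: "v \<in> vertices n"
    have "type_a ?x v \<or> type_b ?x v \<or> type_c ?x v" using packed_state_type(1) v by (cases v) auto
    then show "0 \<le> a * (if type_a ?x v then 1 else w) \<and>
        a * (if type_a ?x v then 1 else w) \<le> vertex_weight a b c ?x v"
      using abc w by (auto simp: vertex_weight_type)
  qed
  finally show ?thesis by (simp add: weight_eq_prod)
qed

end

section \<open>Reflection\<close>

text \<open>Reflection reverses the horizontal direction, hence the negation. \<open>Hor i j\<close>
  lies between columns \<open>i\<close> and \<open>i + 1\<close>, so it corresponds to
  \<open>n - i\<close>, while a column \<open>i\<close> corresponds to \<open>n + 1 - i\<close>.
  Types a and b are exchanged and type c is kept.\<close>

definition mirror :: "nat \<Rightarrow> orientation \<Rightarrow> orientation" where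
  "mirror n x = (\<lambda>e. if e \<in> edges n then
     (case e of Hor i j \<Rightarrow> \<not> x (Hor (n - i) j) | Ver i j \<Rightarrow> x (Ver (n + 1 - i) j)) else undefined)"

lemma mirror_Hor: "i \<le> n \<Longrightarrow> 1 \<le> j \<Longrightarrow> j \<le> n \<Longrightarrow> mirror n x (Hor i j) \<longleftrightarrow> \<not> x (Hor (n - i) j)"
  by (simp add: mirror_def)

lemma mirror_Ver: "1 \<le> i \<Longrightarrow> i \<le> n \<Longrightarrow> j \<le> n \<Longrightarrow> mirror n x (Ver i j) \<longleftrightarrow> x (Ver (n + 1 - i) j)"
  by (simp add: mirror_def)

lemma mirror_twice:
  assumes "x \<in> extensional (edges n)"
  shows "mirror n (mirror n x) = x"
proof
  fix e
  show "mirror n (mirror n x) e = x e"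
  proof (cases "e \<in> edges n")
    case True
    then show ?thesis by (cases e) (auto simp: mirror_Hor mirror_Ver Suc_diff_le)
  qed (use assms in \<open>simp add: mirror_def extensional_def\<close>)
qed

lemma mirror_types:
  assumes "(i, j) \<in> vertices n"
  shows "type_a (mirror n x) (i, j) \<longleftrightarrow> type_b x (n + 1 - i, j)"
    "type_b (mirror n x) (i, j) \<longleftrightarrow> type_a x (n + 1 - i, j)"
    "type_c (mirror n x) (i, j) \<longleftrightarrow> type_c x (n + 1 - i, j)"
proof -
  have ij: "1 \<le> i" "i \<le> n" "1 \<le> j" "j \<le> n" using assms by (auto simp: vertices_def)
  then have e: "n - (i - 1) = n + 1 - i" "n + 1 - i - 1 = n - i" by auto
  have "mirror n x (Hor i j) \<longleftrightarrow> \<not> x (Hor (n + 1 - i - 1) j)" "mirror n x (Hor (i - 1) j) \<longleftrightarrow> \<not> x (Hor (n + 1 - i) j)"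
    "mirror n x (Ver i j) \<longleftrightarrow> x (Ver (n + 1 - i) j)" "mirror n x (Ver i (j - 1)) \<longleftrightarrow> x (Ver (n + 1 - i) (j - 1))"
    using ij e mirror_Hor[of i n j x] mirror_Hor[of "i - 1" n j x] mirror_Ver[of i n j x] mirror_Ver[of i n "j - 1" x]
    by auto
  then show "type_a (mirror n x) (i, j) \<longleftrightarrow> type_b x (n + 1 - i, j)"
    "type_b (mirror n x) (i, j) \<longleftrightarrow> type_a x (n + 1 - i, j)"
    "type_c (mirror n x) (i, j) \<longleftrightarrow> type_c x (n + 1 - i, j)"
    unfolding type_a.simps type_b.simps type_c.simps by blast+
qed

lemma mirror_states:
  assumes x: "x \<in> states n \<beta>"
  shows "mirror n x \<in> states n (mirror n \<beta>)"
proof -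
  have ty: "\<And>v. v \<in> vertices n \<Longrightarrow> type_a x v \<or> type_b x v \<or> type_c x v"
    and bd: "\<And>e. e \<in> dangling_edges n \<Longrightarrow> x e = \<beta> e"
    using x unfolding states_iff by blast+
  have "mirror n x \<in> extensional (edges n)" by (simp add: mirror_def extensional_def)
  moreover have "type_a (mirror n x) v \<or> type_b (mirror n x) v \<or> type_c (mirror n x) v" if "v \<in> vertices n" for v
  proof -
    obtain i j where ij: "v = (i, j)" by (cases v)
    have "(n + 1 - i, j) \<in> vertices n" using that ij by (auto simp: vertices_def)
    then show ?thesis using ty mirror_types[of i j n x] that unfolding ij by blast
  qed
  moreover have "mirror n x e = mirror n \<beta> e" if e: "e \<in> dangling_edges n" for e
  proof (cases e)
    case (Hor i j)
    then have "Hor (n - i) j \<in> dangling_edges n" "i \<le> n" "1 \<le> j" "j \<le> n" using e by auto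
    then show ?thesis using bd[of "Hor (n - i) j"] Hor by (simp add: mirror_Hor)
  next
    case (Ver i j)
    then have "Ver (n + 1 - i) j \<in> dangling_edges n" "1 \<le> i" "i \<le> n" "j \<le> n" using e by auto
    then show ?thesis using bd[of "Ver (n + 1 - i) j"] Ver by (simp add: mirror_Ver)
  qed
  ultimately show ?thesis unfolding states_iff by blast
qed

text \<open>\<open>\<beta>\<close> need not be extensional, so reflecting it twice restores it only
  on the edges of the grid; the dangling edges are all that \<open>states\<close> reads.\<close>

lemma mirror_states_cancel:
  assumes "x \<in> states n (mirror n \<beta>)"
  shows "mirror n x \<in> states n \<beta>"
proof -
  have eq: "mirror n (mirror n \<beta>) e = \<beta> e" if "e \<in> dangling_edges n" for e
  proof -
    have "e \<in> edges n" using that by (simp add: dangling_edges_def)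
    then show ?thesis by (cases e) (auto simp: mirror_Hor mirror_Ver Suc_diff_le)
  qed
  have "mirror n x \<in> states n (mirror n (mirror n \<beta>))" using mirror_states[OF assms] .
  then show ?thesis using eq by (simp add: states_def)
qed

lemma mirror_weight: "weight b a c n (mirror n x) = weight a b c n x"
proof -
  let ?f = "\<lambda>(i, j). (n + 1 - i, j)"
  have "bij_betw ?f (vertices n) (vertices n)"
    by (rule bij_betw_byWitness[of _ ?f]) (auto simp: vertices_def)
  then have "weight a b c n x = (\<Prod>v \<in> vertices n. vertex_weight a b c x (?f v))"
    unfolding weight_eq_prod by (rule prod.reindex_bij_betw[symmetric])
  also have "\<dots> = weight b a c n (mirror n x)"
    unfolding weight_eq_prod
    by (rule prod.cong) (auto simp: vertex_weight_def mirror_types simp del: type_a.simps type_b.simps type_c.simps)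
  finally show ?thesis by simp
qed

lemma mirror_cell:
  assumes "(i, j) \<in> cells n"
  shows "directed_cycle (mirror n x) (i, j) \<longleftrightarrow> directed_cycle x (n - i, j)"
    "reverse_cell (mirror n x) (i, j) = mirror n (reverse_cell x (n - i, j))"
proof -
  have ij: "1 \<le> i" "i < n" "1 \<le> j" "j < n" using assms by (auto simp: cells_def)
  then show "directed_cycle (mirror n x) (i, j) \<longleftrightarrow> directed_cycle x (n - i, j)"
    by (auto simp: mirror_Hor mirror_Ver Suc_diff_le)
  show "reverse_cell (mirror n x) (i, j) = mirror n (reverse_cell x (n - i, j))"
  proof
    fix e
    show "reverse_cell (mirror n x) (i, j) e = mirror n (reverse_cell x (n - i, j)) e"
    proof (cases "e \<in> edges n")
      case True
      then show ?thesis
      proof (cases e)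
        case (Hor k l)
        then have "n - k = n - i \<longleftrightarrow> k = i" using True ij by auto
        then show ?thesis using True Hor by (simp add: mirror_Hor reverse_cell_def)
      next
        case (Ver k l)
        then have "n + 1 - k = n - i + 1 \<longleftrightarrow> k = i" "n + 1 - k = n - i \<longleftrightarrow> k = i + 1" using True ij by auto
        then show ?thesis using True Ver by (auto simp: mirror_Ver reverse_cell_def)
      qed
    next
      case False
      then have "e \<notin> cell_edges (i, j)" using ij by auto
      then show ?thesis using False by (simp add: reverse_cell_def mirror_def)
    qed
  qed
qed

lemma mirror_bottleneck:
  assumes abc: "0 < a" "0 < b" "0 < c" and S: "bottleneck a b c n \<beta> \<epsilon> S"
  shows "bottleneck b a c n (mirror n \<beta>) \<epsilon> (mirror n ` S)"
proof -
  let ?w = "weight a b c n" and ?w' = "weight b a c n"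
  have sub: "S \<subseteq> states n \<beta>" using S by (simp add: bottleneck_def)
  have twice: "mirror n (mirror n x) = x" if "x \<in> states n \<gamma>" for x \<gamma>
    using that by (intro mirror_twice) (simp add: states_iff)
  have inj: "inj_on (mirror n) (states n \<beta>)"
    by (rule inj_on_inverseI[of _ "mirror n"]) (rule twice)
  have img: "mirror n ` states n \<beta> = states n (mirror n \<beta>)"
  proof
    show "states n (mirror n \<beta>) \<subseteq> mirror n ` states n \<beta>"
      using mirror_states_cancel twice by (metis image_eqI subsetI)
  qed (use mirror_states in blast)
  have sum: "sum ?w' (mirror n ` A) = sum ?w A" if "A \<subseteq> states n \<beta>" for A
    using inj_on_subset[OF inj that] by (simp add: sum.reindex mirror_weight)
  have diff: "states n (mirror n \<beta>) - mirror n ` S = mirror n ` (states n \<beta> - S)"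
    using inj_on_image_set_diff[OF inj, of "states n \<beta>" S] sub by (simp add: img)
  let ?B = "\<lambda>S. {x \<in> S. \<exists>q \<in> cells n. directed_cycle x q \<and> reverse_cell x q \<notin> S}"
  have bnd: "?B (mirror n ` S) \<subseteq> mirror n ` ?B S"
  proof
    fix y assume y: "y \<in> ?B (mirror n ` S)"
    then obtain x i j where x: "x \<in> S" "y = mirror n x" and ij: "(i, j) \<in> cells n"
      "directed_cycle y (i, j)" "reverse_cell y (i, j) \<notin> mirror n ` S" by auto
    have "(n - i, j) \<in> cells n" using ij(1) by (auto simp: cells_def)
    moreover have "directed_cycle x (n - i, j)" using mirror_cell(1)[OF ij(1)] ij(2) x(2) by simp
    moreover have "reverse_cell x (n - i, j) \<notin> S" using mirror_cell(2)[OF ij(1)] ij(3) x(2) by auto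
    ultimately show "y \<in> mirror n ` ?B S" using x by blast
  qed
  have "sum ?w' (?B (mirror n ` S)) \<le> sum ?w' (mirror n ` ?B S)"
    by (rule sum_mono2[OF _ bnd])
      (use finite_subset[OF sub finite_states] weight_pos[of b a c n] abc in \<open>auto simp: less_imp_le\<close>)
  also have "\<dots> = sum ?w (?B S)" by (rule sum) (use sub in auto)
  also have "\<dots> \<le> \<epsilon> * sum ?w' (mirror n ` S)" using S sum[OF sub] by (simp add: bottleneck_def)
  finally have "sum ?w' (?B (mirror n ` S)) \<le> \<epsilon> * sum ?w' (mirror n ` S)" .
  moreover have "sum ?w' (mirror n ` S) \<le> sum ?w' (states n (mirror n \<beta>) - mirror n ` S)"
    using S unfolding diff by (simp add: sum sub bottleneck_def)
  moreover have "mirror n ` S \<subseteq> states n (mirror n \<beta>)" "mirror n ` S \<noteq> {}"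
    using S img by (auto simp: bottleneck_def)
  ultimately show ?thesis unfolding bottleneck_def by blast
qed

section \<open>The theorem\<close>

lemma ferroelectric_bottleneck:
  fixes a b c :: real
  assumes abc: "0 < a" "0 < b" "0 < c" and ferro: "b + c < a"
  shows "\<forall>\<^sub>F n in sequentially. \<exists>\<beta> S. bottleneck a b c n \<beta> (exp (- (real n powr (1 / 7))) / 4) S"
proof -
  define l where "l = (b + c) / a"
  define p where "p = b / (b + c)"
  define q where "q = c / (b + c)"
  define w where "w = min (b / a) (c / a)"
  have l: "0 < l" "l < 1" using abc ferro by (auto simp: l_def)
  have pq: "0 < p" "0 < q" "p + q = 1" using abc by (auto simp: p_def q_def simp flip: add_divide_distrib)
  have b: "b = a * (l * p)" and c: "c = a * (l * q)" using abc by (auto simp: l_def p_def q_def)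
  have w: "0 < w" "w \<le> 1" "a * w \<le> b" "a * w \<le> c" using abc ferro by (auto simp: w_def min_def field_simps)
  have "\<exists>K. l ^ K < w ^ 3"
    using real_arch_pow_inv[of "w ^ 3" l] w l by auto
  then obtain K0 where "l ^ K0 < w ^ 3" ..
  \<comment> \<open>Passing to \<open>Suc K0\<close> makes \<open>K\<close> positive by
    construction.\<close>
  then have K: "l ^ Suc K0 < w ^ 3"
    by (rule le_less_trans[rotated]) (use l in \<open>auto intro: power_decreasing\<close>)
  define K where "K = Suc K0"
  define r where "r n = nat \<lceil>real n powr (2 / 3)\<rceil>" for n :: nat
  define D where "D n = 2 * r n + 3" for n
  define E where "E n = 4 * real n * exp (1 + 3 * (p / q) - (real n powr (2 / 3) - 3) / sqrt (real n))" for n :: nat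
  have r_bounds: "real n powr (2 / 3) \<le> real (r n)" "real (r n) \<le> real n powr (2 / 3) + 1" for n
    by (auto simp: r_def intro: real_nat_ceiling_ge)
  \<comment> \<open>The corner term in the count for the packed state is O(n^(2/3)) and so at most
    \<open>n\<close>, which turns \<open>2 * n\<close> plus corners into the exponent
    \<open>3 * n\<close> behind the choice of \<open>K\<close>.\<close>
  have "\<forall>\<^sub>F n in sequentially. 4 * ((real K * (2 * (real n powr (2 / 3) + 1) + 3) + 1) * real K) \<le> real n"
    by real_asymp
  moreover have "\<forall>\<^sub>F n in sequentially. 3 \<le> real n powr (2 / 3)" by real_asymp
  moreover have "\<forall>\<^sub>F n in sequentially. p / q \<le> sqrt (real n)" by real_asymp
  moreover have "\<forall>\<^sub>F n in sequentially. E n \<le> 1 / 2" unfolding E_def by real_asymp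
  \<comment> \<open>\<open>E n\<close> decays like n exp(-n^(1/6)) up to a factor with exponent of
    order n^(-1/2); the return probability contributes n^2, and the exponent 1/7 leaves room for
    both powers.\<close>
  moreover have "\<forall>\<^sub>F n in sequentially.
      real K * (E n / (min p q / (36 * (real n)\<^sup>2))) \<le> exp (- (real n powr (1 / 7))) / 4"
  proof -
    define \<mu> where "\<mu> = min p q"
    have "0 < \<mu>" "0 < real K" using pq by (auto simp: \<mu>_def K_def)
    then show ?thesis unfolding E_def \<mu>_def[symmetric] by real_asymp
  qed
  moreover have "\<forall>\<^sub>F n in sequentially. 1 \<le> real n" by real_asymp
  ultimately show ?thesis
  proof eventually_elim
    case (elim n)
    define \<epsilon> where "\<epsilon> = E n / (min p q / (36 * (real n)\<^sup>2))"
    define S where "S = tube_states n K (D n) (r n)"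
    define \<beta> where "\<beta> = lines_boundary n K (D n)"
    have r3: "3 \<le> r n" using elim(2) r_bounds(1)[of n] by linarith
    have "real (4 * ((K * D n + 1) * K)) = 4 * ((real K * real (D n) + 1) * real K)"
      by (simp add: algebra_simps)
    also have "\<dots> \<le> 4 * ((real K * (2 * (real n powr (2 / 3) + 1) + 3) + 1) * real K)"
      using r_bounds(2)[of n]
      by (intro mult_left_mono mult_right_mono add_right_mono) (simp_all add: D_def)
    finally have KDn: "4 * ((K * D n + 1) * K) \<le> n" using elim(1) by linarith
    have "K * D n + 1 \<le> (K * D n + 1) * K" by (simp add: K_def)
    then have KD: "K * D n < n" "n + 2 * (K * D n) + 1 \<le> 2 * n" using KDn by linarith+
    have D: "2 * r n + 3 \<le> D n" "1 \<le> D n" by (auto simp: D_def)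
    have bounds: "(\<Sum>ts | ts \<in> tube_walks (n - k * D n) (int (r n)) \<and>
          (\<exists>t \<le> 2 * (n - k * D n). int (r n) - 2 \<le> \<bar>disp (take t ts)\<bar>). walk_wt p q ts) \<le> E n"
      "min p q / (36 * (real n)\<^sup>2) \<le> (\<Sum>ts \<in> tube_walks (n - k * D n) (int (r n)). walk_wt p q ts)"
      if k: "k \<in> {1..K}" for k
    proof -
      have m: "1 \<le> n - k * D n" "n - k * D n \<le> n"
        using le_less_trans[OF mult_le_mono1[of k K "D n"] KD(1)] k by auto
      have "(real n powr (2 / 3) - 3) / sqrt (real n) \<le> (of_int (int (r n)) - 3) / sqrt (real n)"
        using r_bounds(1)[of n] by (intro divide_right_mono) auto
      then have le: "4 * real n * exp (1 + 3 * (p / q) - (of_int (int (r n)) - 3) / sqrt (real n)) \<le> E n"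
        unfolding E_def by (intro mult_left_mono) auto
      have small: "4 * real n * exp (1 + 3 * (p / q) - (of_int (int (r n)) - 3) / sqrt (real n)) \<le> 1 / 2"
        using le elim(4) by linarith
      have "3 \<le> int (r n)" using r3 by simp
      note tb = tube_walks_bounds[OF pq m this elim(3) small]
      show "(\<Sum>ts | ts \<in> tube_walks (n - k * D n) (int (r n)) \<and>
          (\<exists>t \<le> 2 * (n - k * D n). int (r n) - 2 \<le> \<bar>disp (take t ts)\<bar>). walk_wt p q ts) \<le> E n"
        using tb(1) le by linarith
      show "min p q / (36 * (real n)\<^sup>2) \<le> (\<Sum>ts \<in> tube_walks (n - k * D n) (int (r n)). walk_wt p q ts)"
        using tb(2) .
    qed
    have g: "0 < min p q / (36 * (real n)\<^sup>2)" using pq elim(6) by auto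
    have \<epsilon>0: "0 \<le> \<epsilon>" unfolding \<epsilon>_def by (rule divide_nonneg_pos[OF _ g]) (simp add: E_def)
    have near: "(\<Sum>ts | ts \<in> tube_walks (n - k * D n) (int (r n)) \<and>
          (\<exists>t \<le> 2 * (n - k * D n). int (r n) - 2 \<le> \<bar>disp (take t ts)\<bar>). walk_wt p q ts) \<le>
        \<epsilon> * (\<Sum>ts \<in> tube_walks (n - k * D n) (int (r n)). walk_wt p q ts)" if k: "k \<in> {1..K}" for k
    proof -
      have "E n = \<epsilon> * (min p q / (36 * (real n)\<^sup>2))"
        unfolding \<epsilon>_def using g by (metis less_irrefl nonzero_eq_divide_eq)
      also have "\<dots> \<le> \<epsilon> * (\<Sum>ts \<in> tube_walks (n - k * D n) (int (r n)). walk_wt p q ts)"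
        by (rule mult_left_mono[OF bounds(2)[OF k] \<epsilon>0])
      finally show ?thesis using bounds(1)[OF k] by linarith
    qed
    have r1: "1 \<le> r n" using r3 by simp
    note tw = tube_states_weights[OF r1 D(1) KD(1) pq abc(1) l(1) less_imp_le[OF l(2)] b c \<epsilon>0 near]
    have sub: "S \<subseteq> states n \<beta>" by (auto simp: S_def \<beta>_def tube_states_def)
    have wp: "0 < weight a b c n x" for x using weight_pos abc by simp
    have wS: "sum (weight a b c n) S < weight a b c n (packed_state n K (D n))"
    proof -
      have "sum (weight a b c n) S \<le> a ^ (n * n) * l ^ (n * K)" using tw(2) KD(2) by (simp add: S_def)
      also have "\<dots> < a ^ (n * n) * w ^ (3 * n)"
      proof (rule mult_strict_left_mono)
        have "(l ^ K) ^ n < (w ^ 3) ^ n" using K l elim(6) by (intro power_strict_mono) (auto simp: K_def)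
        then show "l ^ (n * K) < w ^ (3 * n)" by (simp add: mult.commute[of n] power_mult)
      qed (use abc in simp)
      also have "\<dots> \<le> weight a b c n (packed_state n K (D n))"
        by (rule packed_state_weight[OF D(2) KD(1) _ abc(1) w]) (use KDn in simp)
      finally show ?thesis .
    qed
    have ne: "S \<noteq> {}"
    proof -
      have "tube_walks (n - k * D n) (int (r n)) \<noteq> {}" if "k \<in> {1..K}" for k
        using bounds(2)[OF that] g by (metis not_le sum.empty)
      then have "Pi\<^sub>E {1..K} (\<lambda>k. tube_walks (n - k * D n) (int (r n))) \<noteq> {}" by (simp add: PiE_eq_empty_iff)
      then show ?thesis using lines_state_in_tube_states[OF r1 D(1) KD(1)] by (auto simp: S_def)
    qed
    have packed: "packed_state n K (D n) \<in> states n \<beta> - S"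
    proof -
      \<comment> \<open>The packed state outweighs the whole of \<open>S\<close>, so it cannot be
        one of its members. No geometric argument enters.\<close>
      have "packed_state n K (D n) \<notin> S"
      proof
        assume "packed_state n K (D n) \<in> S"
        then have "weight a b c n (packed_state n K (D n)) \<le> sum (weight a b c n) S"
          by (rule member_le_sum) (use wp finite_subset[OF sub finite_states] in \<open>auto simp: less_imp_le\<close>)
        then show False using wS by simp
      qed
      then show ?thesis using packed_state_in_states[OF D(2) KD(1)] by (simp add: \<beta>_def)
    qed
    have "sum (weight a b c n) S \<le> sum (weight a b c n) (states n \<beta> - S)"
    proof -
      have "weight a b c n (packed_state n K (D n)) \<le> sum (weight a b c n) (states n \<beta> - S)"
        by (rule member_le_sum[OF packed]) (use wp in \<open>auto simp: less_imp_le\<close>)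
      then show ?thesis using wS by linarith
    qed
    moreover have "sum (weight a b c n) {x \<in> S. \<exists>q \<in> cells n. directed_cycle x q \<and> reverse_cell x q \<notin> S}
        \<le> exp (- (real n powr (1 / 7))) / 4 * sum (weight a b c n) S"
    proof -
      have "0 \<le> sum (weight a b c n) S" using wp by (intro sum_nonneg) (auto simp: less_imp_le)
      then have "real K * \<epsilon> * sum (weight a b c n) S \<le> exp (- (real n powr (1 / 7))) / 4 * sum (weight a b c n) S"
        using elim(5) by (intro mult_right_mono) (auto simp: \<epsilon>_def)
      then show ?thesis using tw(1) unfolding S_def by linarith
    qed
    ultimately have "bottleneck a b c n \<beta> (exp (- (real n powr (1 / 7))) / 4) S"
      using sub ne by (simp add: bottleneck_def)
    then show ?case by blast
  qed
qed

theorem theorem1: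
  fixes a b c :: real
  assumes "a > 0" and "b > 0" and "c > 0"
    and "a > b + c \<or> b > a + c"
  shows "\<exists>\<beta> :: nat \<Rightarrow> orientation.
    (\<forall>n. states n (\<beta> n) \<noteq> {}) \<and>
    (\<exists>\<kappa> > 0. \<exists>C > 0. \<forall>\<^sub>F n in sequentially.
       ereal (C * exp (real n powr \<kappa>)) \<le> ereal_of_enat (mixing_time a b c n (\<beta> n) (1 / 4)))"
proof -
  let ?\<epsilon> = "\<lambda>n. exp (- (real n powr (1 / 7))) / 4"
  have "\<forall>\<^sub>F n in sequentially. \<exists>\<beta> S. bottleneck a b c n \<beta> (?\<epsilon> n) S"
    using assms(4)
  proof
    assume "a > b + c"
    then show ?thesis using ferroelectric_bottleneck[OF assms(1-3)] by simp
  next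
    assume "b > a + c"
    then have "\<forall>\<^sub>F n in sequentially. \<exists>\<beta> S. bottleneck b a c n \<beta> (?\<epsilon> n) S"
      using ferroelectric_bottleneck[OF assms(2,1,3)] by simp
    then show ?thesis
      \<comment> \<open>Reflecting a bottleneck for the weights \<open>b\<close>, \<open>a\<close>,
        \<open>c\<close> gives one for \<open>a\<close>, \<open>b\<close>, \<open>c\<close>.\<close>
      by eventually_elim (use mirror_bottleneck[OF assms(2,1,3)] in blast)
  qed
  then have ev: "\<forall>\<^sub>F n in sequentially. \<exists>\<beta>. states n \<beta> \<noteq> {} \<and>
      ereal (exp (real n powr (1 / 7))) \<le> ereal_of_enat (mixing_time a b c n \<beta> (1 / 4))"
  proof eventually_elim
    case (elim n)
    then obtain \<beta> S where S: "bottleneck a b c n \<beta> (?\<epsilon> n) S" by blast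
    then have "ereal (1 / (4 * ?\<epsilon> n)) \<le> ereal_of_enat (mixing_time a b c n \<beta> (1 / 4))"
      by (intro mixing_time_ge[OF assms(1-3)]) auto
    moreover have "states n \<beta> \<noteq> {}" using S by (auto simp: bottleneck_def)
    moreover have "1 / (4 * ?\<epsilon> n) = exp (real n powr (1 / 7))" by (simp add: exp_minus field_simps)
    ultimately show ?case by auto
  qed
  define good where "good n \<beta> \<longleftrightarrow> states n \<beta> \<noteq> {} \<and>
      ereal (exp (real n powr (1 / 7))) \<le> ereal_of_enat (mixing_time a b c n \<beta> (1 / 4))" for n \<beta>
  \<comment> \<open>Bottlenecks exist only for large \<open>n\<close>. For the other sizes all edges
    point right or up, which is a legal state, so that the state space is nonempty for every
    \<open>n\<close>.\<close>
  define \<beta> where "\<beta> n = (if \<exists>\<beta>. good n \<beta> then SOME \<beta>. good n \<beta> else (\<lambda>_. True))" for n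
  have \<beta>: "good n (\<beta> n)" if "\<exists>\<beta>. good n \<beta>" for n
    using someI_ex[OF that] that by (simp add: \<beta>_def)
  have "states n (\<lambda>_. True) \<noteq> {}" for n
  proof -
    have "restrict (\<lambda>_. True) (edges n) \<in> states n (\<lambda>_. True)"
      by (auto simp: states_iff vertices_def dangling_edges_def)
    then show ?thesis by blast
  qed
  then have "states n (\<beta> n) \<noteq> {}" for n
    using \<beta>[of n] by (cases "\<exists>\<beta>. good n \<beta>") (auto simp: good_def \<beta>_def)
  moreover have "\<forall>\<^sub>F n in sequentially.
      ereal (1 * exp (real n powr (1 / 7))) \<le> ereal_of_enat (mixing_time a b c n (\<beta> n) (1 / 4))"
    using ev by eventually_elim (use \<beta> in \<open>auto simp: good_def\<close>)
  ultimately show ?thesis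
    by (intro exI[of _ \<beta>] conjI allI exI[of _ "1 / 7 :: real"] exI[of _ "1 :: real"]) auto
qed

end
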